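(* Let $\{V_i\}_{i=1}^m$ be an $(m,l,d)$-reconstruction system on the Hilbert space $\mathcal H$, with analysis operator $V$, such that $\operatorname{tr}(V^*V)=\sum_{i=1}^m \operatorname{tr}(V_i^*V_i)\ge d$. Then (1) $\frac{d}{l}\,I_l\prec_w \mathbf P_q(V)$. Hence: (2) for every unitarily invariant norm $\|\cdot\|$ on $M_l(\mathbb C)$ with associated symmetric gauge function $\psi$, $\ d\cdot \eta_\psi(l)\le \|\mathbf P_q(V)\|$; and (3) for every increasing convex function $f:\mathbb R_{\ge 0}\to\mathbb R$ with $f(0)=0$, $\ l\cdot f\!\left(\frac{d}{l}\right)\le \operatorname{tr}(f(\mathbf P_q(V)))$. If majorization holds in (1) (i.e. $\frac{d}{l}I_l\prec \mathbf P_q(V)$), or there exists a unitarily invariant norm for which equality holds in (2), or there exists an increasing strictly convex function $f:\mathbb R_{\ge0}\to\mathbb R_{\ge 0}$ with $f(0)=0$ for which equality holds in (3), then $\{V_i\}_{i=1}^m$ is an $(m,l,d)$-protocol. Moreover, if $\{V_i\}_{i=1}^m$ is a projective rank-$l$ $(m,l,d)$-protocol, then majorization holds in (1), and the lower bounds in (2) and (3) are attained for every unitarily invariant norm on $M_l(\mathbb C)$ and every increasing convex function $f:\mathbb R_{\ge 0}\to\mathbb R$ with $f(0)=0$, respectively.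
   Context: $\mathbb F$ is $\mathbb R$ or $\mathbb C$; $\mathcal H=\mathbb F^d$, $\mathcal K=\mathbb F^l$ with $l<d$. An $(m,l,d)$-reconstruction system is a family $\{V_i\}_{i=1}^m$ of linear operators $V_i:\mathcal H\to\mathcal K$ such that $\sum_{i=1}^m V_i^*V_i$ is invertible. It is an $(m,l,d)$-protocol if $\sum_{i=1}^m V_i^*V_i=I_d$. Its analysis operator is $V:\mathcal H\to\bigoplus_{i=1}^m\mathcal K$, $Vx=\bigoplus_{i=1}^m V_ix$, so $V^*V=\sum_i V_i^*V_i$. Its $q$-potential is $\mathbf P_q(V)=\sum_{i,j=1}^m |V_iV_j^*|^2$, a positive semidefinite $l\times l$ matrix, where $|A|^2=A^*A$. A protocol is projective if for each $i$, $V_i^*V_i=w_iP_i$ with $P_i$ an orthogonal projection on $\mathcal H$ and $w_i>0$; it is rank-$l$ if $\operatorname{rank}(V_i^* )=l$ for all $i$. For $x,y\in\mathbb R^l$, with $x^\downarrow$ the non-increasing rearrangement of $x$, $x\prec_w y$ (submajorization) means $\sum_{i=1}^k x_i^\downarrow\le\sum_{i=1}^k y_i^\downarrow$ for $1\le k\le l$; $x\prec y$ (majorization) means in addition $\sum_i x_i=\sum_i y_i$. For self-adjoint $l\times l$ matrices, $A\prec_w B$ (resp. $A\prec B$) means $\lambda(A)\prec_w\lambda(B)$ (resp. $\lambda(A)\prec\lambda(B)$), where $\lambda(A)$ is the vector of eigenvalues counted with multiplicity in decreasing order. The symmetric gauge function $\psi:\mathbb R^l\to\mathbb R_{\ge0}$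 associated with a unitarily invariant norm $\|\cdot\|$ on $M_l$ satisfies $\|A\|=\psi(s(A))$, where $s(A)$ is the vector of singular values of $A$. $\eta_\psi(l)=\frac{\psi(\mathbf e_l)}{l}=\frac{\|I_l\|}{l}$, where $\mathbf e_l=(1,\dots,1)\in\mathbb R^l$. $\operatorname{tr}$ is the unnormalized trace, and $f(A)$ is defined by functional calculus. *)

theory Defs
  imports
    "Jordan_Normal_Form.Schur_Decomposition"
    "Jordan_Normal_Form.DL_Rank"
    "HOL-Analysis.Convex"
begin

text \<open>
  The class has exactly two models up to isomorphism, the reals and the complex numbers: the
  embedding into the complex numbers is injective, and its range is one of these two fields.
  It serves to regard a matrix over the scalar field as a complex matrix.
\<close>

class real_or_complex = conjugatable_field + real_algebra_1 +
  fixes to_complex :: "'a \<Rightarrow> complex"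
  assumes to_complex_add: "to_complex (x + y) = to_complex x + to_complex y"
    and to_complex_mult: "to_complex (x * y) = to_complex x * to_complex y"
    and to_complex_scaleR: "to_complex (r *\<^sub>R x) = r *\<^sub>R to_complex x"
    and to_complex_conjugate: "to_complex (conjugate x) = cnj (to_complex x)"
    and to_complex_eq_iff: "to_complex x = to_complex y \<longleftrightarrow> x = y"
    and range_to_complex: "range to_complex = \<real> \<or> range to_complex = UNIV"

instantiation real :: real_or_complex
begin

definition to_complex_real :: "real \<Rightarrow> complex" where
  "to_complex_real x = complex_of_real x"

instance
  by intro_classes (auto simp: to_complex_real_def Reals_def scaleR_conv_of_real)

end

instantiation complex :: real_or_complex
begin

definition to_complex_complex :: "complex \<Rightarrow> complex" where
  "to_complex_complex z = z"

instance
  by intro_classes (auto simp: to_complex_complex_def)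

end

definition mat_sum :: "nat \<Rightarrow> nat \<Rightarrow> ('i \<Rightarrow> 'a::comm_monoid_add mat) \<Rightarrow> 'i set \<Rightarrow> 'a mat" where
  "mat_sum nr nc F I = mat nr nc (\<lambda>(a, b). \<Sum>i\<in>I. F i $$ (a, b))"

definition mat_trace :: "'a::comm_monoid_add mat \<Rightarrow> 'a" where
  "mat_trace A = (\<Sum>i<dim_row A. A $$ (i, i))"

definition abs_square :: "'a::conjugatable_field mat \<Rightarrow> 'a mat" where
  "abs_square A = mat_adjoint A * A"

definition orthogonal_projection :: "nat \<Rightarrow> 'a::conjugatable_field mat \<Rightarrow> bool" where
  "orthogonal_projection n P \<longleftrightarrow> P \<in> carrier_mat n n \<and> P * P = P \<and> mat_adjoint P = P"

definition unitary_mat :: "nat \<Rightarrow> complex mat \<Rightarrow> bool" where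
  "unitary_mat n U \<longleftrightarrow> U \<in> carrier_mat n n \<and> mat_adjoint U * U = 1\<^sub>m n \<and> U * mat_adjoint U = 1\<^sub>m n"

text \<open>
  The eigenvalues, listed with algebraic multiplicity as the roots of the characteristic polynomial,
  in decreasing order. This is only used for self-adjoint matrices, so that all roots are real
  and the real part loses nothing.
\<close>

definition eigenvalue_vec :: "complex mat \<Rightarrow> real vec" where
  "eigenvalue_vec A =
     vec_of_list (rev (sorted_list_of_multiset (image_mset Re (proots (char_poly A)))))"

definition singular_value_vec :: "complex mat \<Rightarrow> real vec" where
  "singular_value_vec A = map_vec sqrt (eigenvalue_vec (mat_adjoint A * A))"

text \<open>
  For self-adjoint \<open>A\<close>, the value does not depend on the chosen unitary diagonalization of \<open>A\<close>.
\<close>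

definition functional_calculus :: "(real \<Rightarrow> real) \<Rightarrow> complex mat \<Rightarrow> complex mat" where
  "functional_calculus f A =
     (THE B. \<exists>U \<mu>. unitary_mat (dim_row A) U \<and>
        A = U * mat_diag (dim_row A) (\<lambda>i. complex_of_real (\<mu> i)) * mat_adjoint U \<and>
        B = U * mat_diag (dim_row A) (\<lambda>i. complex_of_real (f (\<mu> i))) * mat_adjoint U)"

definition decreasing_rearrangement :: "real vec \<Rightarrow> real vec" where
  "decreasing_rearrangement x = vec_of_list (rev (sort (list_of_vec x)))"

definition submajorized :: "real vec \<Rightarrow> real vec \<Rightarrow> bool" where
  "submajorized x y \<longleftrightarrow> dim_vec x = dim_vec y \<and>
     (\<forall>k\<in>{1..dim_vec x}.
        (\<Sum>i<k. decreasing_rearrangement x $ i) \<le> (\<Sum>i<k. decreasing_rearrangement y $ i))"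

definition majorized :: "real vec \<Rightarrow> real vec \<Rightarrow> bool" where
  "majorized x y \<longleftrightarrow> submajorized x y \<and> (\<Sum>i<dim_vec x. x $ i) = (\<Sum>i<dim_vec y. y $ i)"

definition mat_submajorized :: "complex mat \<Rightarrow> complex mat \<Rightarrow> bool" where
  "mat_submajorized A B \<longleftrightarrow> submajorized (eigenvalue_vec A) (eigenvalue_vec B)"

definition mat_majorized :: "complex mat \<Rightarrow> complex mat \<Rightarrow> bool" where
  "mat_majorized A B \<longleftrightarrow> majorized (eigenvalue_vec A) (eigenvalue_vec B)"

definition unitarily_invariant_norm :: "nat \<Rightarrow> (complex mat \<Rightarrow> real) \<Rightarrow> bool" where
  "unitarily_invariant_norm l N \<longleftrightarrow>
     (\<forall>A\<in>carrier_mat l l. 0 \<le> N A \<and> (N A = 0 \<longleftrightarrow> A = 0\<^sub>m l l)) \<and>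
     (\<forall>A\<in>carrier_mat l l. \<forall>c. N (c \<cdot>\<^sub>m A) = cmod c * N A) \<and>
     (\<forall>A\<in>carrier_mat l l. \<forall>B\<in>carrier_mat l l. N (A + B) \<le> N A + N B) \<and>
     (\<forall>A\<in>carrier_mat l l. \<forall>U W. unitary_mat l U \<and> unitary_mat l W \<longrightarrow> N (U * A * W) = N A)"

definition symmetric_gauge :: "nat \<Rightarrow> (real vec \<Rightarrow> real) \<Rightarrow> bool" where
  "symmetric_gauge l \<psi> \<longleftrightarrow>
     (\<forall>x\<in>carrier_vec l. 0 \<le> \<psi> x \<and> (\<psi> x = 0 \<longleftrightarrow> x = 0\<^sub>v l)) \<and>
     (\<forall>x\<in>carrier_vec l. \<forall>c. \<psi> (c \<cdot>\<^sub>v x) = \<bar>c\<bar> * \<psi> x) \<and>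
     (\<forall>x\<in>carrier_vec l. \<forall>y\<in>carrier_vec l. \<psi> (x + y) \<le> \<psi> x + \<psi> y) \<and>
     (\<forall>x\<in>carrier_vec l. \<forall>p. p permutes {..<l} \<longrightarrow> \<psi> (vec l (\<lambda>i. x $ p i)) = \<psi> x) \<and>
     (\<forall>x\<in>carrier_vec l. \<forall>\<epsilon>. (\<forall>i. \<epsilon> i = 1 \<or> \<epsilon> i = - 1) \<longrightarrow> \<psi> (vec l (\<lambda>i. \<epsilon> i * x $ i)) = \<psi> x)"

definition associated_gauge :: "nat \<Rightarrow> (complex mat \<Rightarrow> real) \<Rightarrow> (real vec \<Rightarrow> real) \<Rightarrow> bool" where
  "associated_gauge l N \<psi> \<longleftrightarrow>
     symmetric_gauge l \<psi> \<and> (\<forall>A\<in>carrier_mat l l. N A = \<psi> (singular_value_vec A))"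

text \<open>The argument is the all-ones vector, so for an associated gauge this is \<open>N I\<^sub>l / l\<close>.\<close>

definition eta :: "(real vec \<Rightarrow> real) \<Rightarrow> nat \<Rightarrow> real" where
  "eta \<psi> l = \<psi> (vec l (\<lambda>_. 1)) / real l"

definition strictly_convex_on :: "real set \<Rightarrow> (real \<Rightarrow> real) \<Rightarrow> bool" where
  "strictly_convex_on S f \<longleftrightarrow> convex S \<and>
     (\<forall>x\<in>S. \<forall>y\<in>S. \<forall>t. x \<noteq> y \<and> 0 < t \<and> t < 1 \<longrightarrow>
        f ((1 - t) * x + t * y) < (1 - t) * f x + t * f y)"

text \<open>
  A family of operators \<open>V\<^sub>0, \<dots>, V\<^sub>m\<^sub>-\<^sub>1\<close> from \<open>d\<close>-dimensional to \<open>l\<close>-dimensional space is a function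
  into the \<open>l \<times> d\<close> matrices, of which only the values at \<open>i < m\<close> matter.
\<close>

definition frame_op :: "nat \<Rightarrow> nat \<Rightarrow> (nat \<Rightarrow> 'a::conjugatable_field mat) \<Rightarrow> 'a mat" where
  "frame_op m d V = mat_sum d d (\<lambda>i. mat_adjoint (V i) * V i) {..<m}"

definition reconstruction_system ::
  "nat \<Rightarrow> nat \<Rightarrow> nat \<Rightarrow> (nat \<Rightarrow> 'a::conjugatable_field mat) \<Rightarrow> bool" where
  "reconstruction_system m l d V \<longleftrightarrow>
     (\<forall>i<m. V i \<in> carrier_mat l d) \<and> invertible_mat (frame_op m d V)"

definition protocol :: "nat \<Rightarrow> nat \<Rightarrow> nat \<Rightarrow> (nat \<Rightarrow> 'a::conjugatable_field mat) \<Rightarrow> bool" where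
  "protocol m l d V \<longleftrightarrow> reconstruction_system m l d V \<and> frame_op m d V = 1\<^sub>m d"

definition projective_protocol ::
  "nat \<Rightarrow> nat \<Rightarrow> nat \<Rightarrow> (nat \<Rightarrow> 'a::real_or_complex mat) \<Rightarrow> bool" where
  "projective_protocol m l d V \<longleftrightarrow> protocol m l d V \<and>
     (\<forall>i<m. \<exists>w::real. \<exists>P. 0 < w \<and> orthogonal_projection d P \<and>
        mat_adjoint (V i) * V i = of_real w \<cdot>\<^sub>m P)"

definition rank_l :: "nat \<Rightarrow> nat \<Rightarrow> nat \<Rightarrow> (nat \<Rightarrow> 'a::conjugatable_field mat) \<Rightarrow> bool" where
  "rank_l m l d V \<longleftrightarrow> (\<forall>i<m. vec_space.rank d (mat_adjoint (V i)) = l)"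

text \<open>The direct sum of \<open>m\<close> copies of \<open>l\<close>-space is \<open>(m * l)\<close>-space, with \<open>V\<^sub>i x\<close> in the \<open>i\<close>-th block.\<close>

definition analysis_op :: "nat \<Rightarrow> nat \<Rightarrow> nat \<Rightarrow> (nat \<Rightarrow> 'a mat) \<Rightarrow> 'a mat" where
  "analysis_op m l d V = mat (m * l) d (\<lambda>(r, c). V (r div l) $$ (r mod l, c))"

definition q_potential :: "nat \<Rightarrow> nat \<Rightarrow> (nat \<Rightarrow> 'a::conjugatable_field mat) \<Rightarrow> 'a mat" where
  "q_potential m l V =
     mat_sum l l (\<lambda>(i, j). abs_square (V i * mat_adjoint (V j))) ({..<m} \<times> {..<m})"

definition q_potential_complex :: "nat \<Rightarrow> nat \<Rightarrow> (nat \<Rightarrow> 'a::real_or_complex mat) \<Rightarrow> complex mat" where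
  "q_potential_complex m l V = map_mat to_complex (q_potential m l V)"

lemma mat_adjoint_dim [simp]:
  "dim_row (mat_adjoint A) = dim_col A" "dim_col (mat_adjoint A) = dim_row A"
  by (simp_all add: mat_adjoint_def)

lemma mat_adjoint_index [simp]:
  "i < dim_col A \<Longrightarrow> j < dim_row A \<Longrightarrow> mat_adjoint A $$ (i, j) = conjugate (A $$ (j, i))"
  by (simp add: mat_adjoint_def mat_of_rows_index)

lemma sum_blocks:
  fixes g :: "nat \<Rightarrow> nat \<Rightarrow> 'b::comm_monoid_add"
  shows "(\<Sum>r<m * l. g (r div l) (r mod l)) = (\<Sum>i<m. \<Sum>k<l. g i k)"
proof -
  have "(\<Sum>r<m * l. g (r div l) (r mod l))
      = (\<Sum>i<m. \<Sum>r\<in>{i * l..<i * l + l}. g (r div l) (r mod l))"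
    by (rule sum.nat_group[symmetric])
  also have "\<dots> = (\<Sum>i<m. \<Sum>k<l. g i k)"
  proof (rule sum.cong[OF refl])
    fix i
    have "(\<Sum>r\<in>{i * l..<i * l + l}. g (r div l) (r mod l))
        = (\<Sum>k\<in>{0..<l}. g ((k + i * l) div l) ((k + i * l) mod l))"
      using sum.shift_bounds_nat_ivl[of "\<lambda>r. g (r div l) (r mod l)" 0 "i * l" l]
      by (simp add: add.commute)
    also have "\<dots> = (\<Sum>k<l. g i k)"
      unfolding lessThan_atLeast0 by (rule sum.cong) auto
    finally show "(\<Sum>r\<in>{i * l..<i * l + l}. g (r div l) (r mod l)) = (\<Sum>k<l. g i k)" .
  qed
  finally show ?thesis .
qed

lemma analysis_op_adjoint_mult:
  assumes "\<forall>i<m. V i \<in> carrier_mat l d"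
  shows "mat_adjoint (analysis_op m l d V) * analysis_op m l d V = frame_op m d V"
proof (rule eq_matI)
  fix a b assume "a < dim_row (frame_op m d V)" "b < dim_col (frame_op m d V)"
  then have ab: "a < d" "b < d" by (auto simp: frame_op_def mat_sum_def)
  have "(mat_adjoint (analysis_op m l d V) * analysis_op m l d V) $$ (a, b)
      = (\<Sum>r<m * l. conjugate (V (r div l) $$ (r mod l, a)) * V (r div l) $$ (r mod l, b))"
    using ab by (simp add: analysis_op_def scalar_prod_def lessThan_atLeast0)
  also have "\<dots> = (\<Sum>i<m. \<Sum>k<l. conjugate (V i $$ (k, a)) * V i $$ (k, b))"
    by (rule sum_blocks)
  also have "\<dots> = (\<Sum>i<m. (mat_adjoint (V i) * V i) $$ (a, b))"
  proof (rule sum.cong[OF refl])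
    fix i assume "i \<in> {..<m}"
    then have "V i \<in> carrier_mat l d" using assms by auto
    then show "(\<Sum>k<l. conjugate (V i $$ (k, a)) * V i $$ (k, b)) = (mat_adjoint (V i) * V i) $$ (a, b)"
      using ab by (auto simp: scalar_prod_def lessThan_atLeast0 intro!: sum.cong)
  qed
  finally show "(mat_adjoint (analysis_op m l d V) * analysis_op m l d V) $$ (a, b) = frame_op m d V $$ (a, b)"
    using ab by (simp add: frame_op_def mat_sum_def)
qed (auto simp: frame_op_def mat_sum_def analysis_op_def)

end

theory Submission
  imports Defs "HOL-Number_Theory.Cong"
begin

text \<open>
  Write \<open>S = \<Sum> V\<^sub>i\<^sup>* V\<^sub>i\<close> for the frame operator and \<open>P\<close> for the \<open>q\<close>-potential. Since
  \<open>P = \<Sum> V\<^sub>j S V\<^sub>j\<^sup>*\<close>, its trace is \<open>tr S\<^sup>2 = 2 tr S - d + \<Sum> |S\<^sub>a\<^sub>b - \<delta>\<^sub>a\<^sub>b|\<^sup>2\<close>, so \<open>tr S \<ge> d\<close> gives \<open>tr P \<ge> d\<close>,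
  with equality only for \<open>S = I\<close>. The eigenvalues of \<open>P\<close> are nonnegative with mean \<open>tr P / l \<ge> d / l\<close>,
  and each of the three bounds compares them with their mean: the largest \<open>k\<close> of them average at least
  the mean, a symmetric gauge does not increase under averaging over cyclic shifts, and for convex
  functions this is Jensen's inequality. Equality in any of them forces \<open>tr P = d\<close>. For a projective protocol
  of rank \<open>l\<close>, each \<open>V\<^sub>j V\<^sub>j\<^sup>*\<close> is a multiple of \<open>I\<close>, and hence so is \<open>P\<close>.
\<close>

section \<open>The trace of the q-potential\<close>

lemma mat_adjoint_carrier [simp]:
  "A \<in> carrier_mat n k \<Longrightarrow> mat_adjoint A \<in> carrier_mat k n"
  by auto

lemma mat_adjoint_adjoint [simp]: "mat_adjoint (mat_adjoint A) = A"
  by (rule eq_matI) auto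

lemma mat_adjoint_zero: "mat_adjoint (0\<^sub>m n k :: 'a::conjugatable_field mat) = 0\<^sub>m k n"
  by (rule eq_matI) auto

lemma mat_adjoint_mult:
  fixes A B :: "'a::conjugatable_field mat"
  assumes "A \<in> carrier_mat n k" "B \<in> carrier_mat k p"
  shows "mat_adjoint (A * B) = mat_adjoint B * mat_adjoint A"
  using assms
  by (intro eq_matI)
    (auto simp: scalar_prod_def sum_conjugate conjugate_dist_mul mult.commute intro!: sum.cong)

text \<open>Source of the positivity arguments: eigenvalues of a Gram matrix are nonnegative, a Gram
  matrix vanishes only with its factor, and \<open>tr (S * S)\<close> for Hermitian S is a sum of
  squared moduli.\<close>

lemma mat_adjoint_mult_self_index:
  fixes A :: "complex mat"
  assumes A: "A \<in> carrier_mat n k" and "j < k"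
  shows "(mat_adjoint A * A) $$ (j, j) = complex_of_real (\<Sum>i<n. (cmod (A $$ (i, j)))\<^sup>2)"
  using assms carrier_matD[OF A]
  by (simp add: scalar_prod_def lessThan_atLeast0 complex_norm_square mult.commute del: of_real_power)

lemma mat_trace_mult_commute:
  fixes A B :: "'a::comm_semiring_0 mat"
  assumes "A \<in> carrier_mat n k" "B \<in> carrier_mat k n"
  shows "mat_trace (A * B) = mat_trace (B * A)"
proof -
  have "mat_trace (A * B) = (\<Sum>i<n. \<Sum>j<k. A $$ (i, j) * B $$ (j, i))"
    using assms by (simp add: mat_trace_def scalar_prod_def lessThan_atLeast0)
  also have "\<dots> = (\<Sum>j<k. \<Sum>i<n. B $$ (j, i) * A $$ (i, j))"
    by (subst sum.swap) (simp add: mult.commute)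
  also have "\<dots> = mat_trace (B * A)"
    using assms by (simp add: mat_trace_def scalar_prod_def lessThan_atLeast0)
  finally show ?thesis .
qed

section \<open>Finite sums of matrices\<close>

lemma mat_sum_carrier [simp]: "mat_sum nr nc F I \<in> carrier_mat nr nc"
  by (simp add: mat_sum_def)

lemma mat_sum_cong:
  "(\<And>i. i \<in> I \<Longrightarrow> F i = G i) \<Longrightarrow> mat_sum nr nc F I = mat_sum nr nc G I"
  by (simp add: mat_sum_def)

lemma mult_mat_sum:
  fixes A :: "'a::comm_semiring_0 mat"
  assumes "A \<in> carrier_mat n nr" "\<And>i. i \<in> I \<Longrightarrow> F i \<in> carrier_mat nr nc"
  shows "A * mat_sum nr nc F I = mat_sum n nc (\<lambda>i. A * F i) I"
proof (rule eq_matI)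
  fix a b assume "a < dim_row (mat_sum n nc (\<lambda>i. A * F i) I)"
    "b < dim_col (mat_sum n nc (\<lambda>i. A * F i) I)"
  then have ab: "a < n" "b < nc" by (auto simp: mat_sum_def)
  have "(A * mat_sum nr nc F I) $$ (a, b) = (\<Sum>k<nr. A $$ (a, k) * (\<Sum>i\<in>I. F i $$ (k, b)))"
    using assms ab by (simp add: mat_sum_def scalar_prod_def lessThan_atLeast0)
  also have "\<dots> = (\<Sum>i\<in>I. \<Sum>k<nr. A $$ (a, k) * F i $$ (k, b))"
    by (simp add: sum_distrib_left) (rule sum.swap)
  also have "\<dots> = (\<Sum>i\<in>I. (A * F i) $$ (a, b))"
  proof (rule sum.cong[OF refl])
    fix i assume "i \<in> I"
    then have "F i \<in> carrier_mat nr nc" by (rule assms)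
    then show "(\<Sum>k<nr. A $$ (a, k) * F i $$ (k, b)) = (A * F i) $$ (a, b)"
      using assms(1) ab by (simp add: scalar_prod_def lessThan_atLeast0)
  qed
  finally show "(A * mat_sum nr nc F I) $$ (a, b) = mat_sum n nc (\<lambda>i. A * F i) I $$ (a, b)"
    using ab by (simp add: mat_sum_def)
qed (use assms in \<open>auto simp: mat_sum_def\<close>)

lemma mat_sum_mult:
  fixes B :: "'a::comm_semiring_0 mat"
  assumes "B \<in> carrier_mat nc n" "\<And>i. i \<in> I \<Longrightarrow> F i \<in> carrier_mat nr nc"
  shows "mat_sum nr nc F I * B = mat_sum nr n (\<lambda>i. F i * B) I"
proof (rule eq_matI)
  fix a b assume "a < dim_row (mat_sum nr n (\<lambda>i. F i * B) I)"
    "b < dim_col (mat_sum nr n (\<lambda>i. F i * B) I)"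
  then have ab: "a < nr" "b < n" by (auto simp: mat_sum_def)
  have "(mat_sum nr nc F I * B) $$ (a, b) = (\<Sum>k<nc. (\<Sum>i\<in>I. F i $$ (a, k)) * B $$ (k, b))"
    using assms ab by (simp add: mat_sum_def scalar_prod_def lessThan_atLeast0)
  also have "\<dots> = (\<Sum>i\<in>I. \<Sum>k<nc. F i $$ (a, k) * B $$ (k, b))"
    by (simp add: sum_distrib_right) (rule sum.swap)
  also have "\<dots> = (\<Sum>i\<in>I. (F i * B) $$ (a, b))"
  proof (rule sum.cong[OF refl])
    fix i assume "i \<in> I"
    then have "F i \<in> carrier_mat nr nc" by (rule assms)
    then show "(\<Sum>k<nc. F i $$ (a, k) * B $$ (k, b)) = (F i * B) $$ (a, b)"
      using assms(1) ab by (simp add: scalar_prod_def lessThan_atLeast0)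
  qed
  finally show "(mat_sum nr nc F I * B) $$ (a, b) = mat_sum nr n (\<lambda>i. F i * B) I $$ (a, b)"
    using ab by (simp add: mat_sum_def)
qed (use assms in \<open>auto simp: mat_sum_def\<close>)

lemma mat_trace_mat_sum:
  assumes "\<And>i. i \<in> I \<Longrightarrow> F i \<in> carrier_mat n n"
  shows "mat_trace (mat_sum n n F I) = (\<Sum>i\<in>I. mat_trace (F i))"
proof -
  have "mat_trace (mat_sum n n F I) = (\<Sum>i\<in>I. \<Sum>a<n. F i $$ (a, a))"
    by (simp add: mat_trace_def mat_sum_def) (rule sum.swap)
  also have "\<dots> = (\<Sum>i\<in>I. mat_trace (F i))"
    using assms by (intro sum.cong) (auto simp: mat_trace_def)
  finally show ?thesis .
qed

lemma frame_op_carrier [simp]: "frame_op m d V \<in> carrier_mat d d"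
  by (simp add: frame_op_def)

text \<open>\<open>|V_i V_j^*|^2 = V_j (V_i^* V_i) V_j^*\<close>, so summing over i with j fixed
  leaves the frame operator between \<open>V_j\<close> and its adjoint.\<close>

lemma q_potential_eq_sum_frame_op:
  fixes V :: "nat \<Rightarrow> 'a::conjugatable_field mat"
  assumes V: "\<And>i. i < m \<Longrightarrow> V i \<in> carrier_mat l d"
  shows "q_potential m l V =
    mat_sum l l (\<lambda>j. V j * frame_op m d V * mat_adjoint (V j)) {..<m}"
proof -
  let ?F = "\<lambda>i j. V j * (mat_adjoint (V i) * V i) * mat_adjoint (V j)"
  have abs: "abs_square (V i * mat_adjoint (V j)) = ?F i j" if ij: "i < m" "j < m" for i j
  proof -
    note [simp] = V[OF ij(1)] V[OF ij(2)]
    have "abs_square (V i * mat_adjoint (V j))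
        = (V j * mat_adjoint (V i)) * (V i * mat_adjoint (V j))"
      by (simp add: abs_square_def mat_adjoint_mult[of _ l d _ l])
    also have "\<dots> = ?F i j"
    proof -
      have "V j * mat_adjoint (V i) * (V i * mat_adjoint (V j))
          = V j * mat_adjoint (V i) * V i * mat_adjoint (V j)"
        by (rule assoc_mult_mat[symmetric, of _ l l _ d _ l]) (simp_all add: mult_carrier_mat[of _ l d])
      also have "V j * mat_adjoint (V i) * V i = V j * (mat_adjoint (V i) * V i)"
        by (rule assoc_mult_mat[of _ l d _ l _ d]) simp_all
      finally show ?thesis .
    qed
    finally show ?thesis .
  qed
  have inner: "V j * frame_op m d V * mat_adjoint (V j) = mat_sum l l (\<lambda>i. ?F i j) {..<m}"
    if j: "j < m" for j
  proof -
    have c: "mat_adjoint (V i) * V i \<in> carrier_mat d d" if "i \<in> {..<m}" for i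
      using V[of i] that by (auto intro!: mult_carrier_mat[of _ d l])
    have "V j * frame_op m d V = mat_sum l d (\<lambda>i. V j * (mat_adjoint (V i) * V i)) {..<m}"
      unfolding frame_op_def by (rule mult_mat_sum) (use V j c in auto)
    moreover have "\<dots> * mat_adjoint (V j) = mat_sum l l (\<lambda>i. ?F i j) {..<m}"
      by (rule mat_sum_mult) (use V j c in \<open>auto intro!: mult_carrier_mat[of _ l d]\<close>)
    ultimately show ?thesis by simp
  qed
  have "q_potential m l V = mat_sum l l (\<lambda>(i, j). ?F i j) ({..<m} \<times> {..<m})"
    unfolding q_potential_def using abs by (intro mat_sum_cong) auto
  also have "\<dots> = mat_sum l l (\<lambda>j. mat_sum l l (\<lambda>i. ?F i j) {..<m}) {..<m}"
  proof -
    \<comment> \<open>The potential sums over pairs (i, j); the sums are swapped to make i the inner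
      index.\<close>
    have "(\<Sum>p\<in>{..<m} \<times> {..<m}. (case p of (i, j) \<Rightarrow> ?F i j) $$ ab)
        = (\<Sum>j<m. \<Sum>i<m. ?F i j $$ ab)" for ab
      by (subst sum.swap) (simp add: sum.cartesian_product case_prod_beta)
    then show ?thesis by (auto simp: mat_sum_def intro!: eq_matI)
  qed
  also have "\<dots> = mat_sum l l (\<lambda>j. V j * frame_op m d V * mat_adjoint (V j)) {..<m}"
    using inner by (intro mat_sum_cong) auto
  finally show ?thesis .
qed

text \<open>Cyclicity of the trace moves the left \<open>V_j\<close> to the far right, and summing
  the resulting \<open>V_j^* V_j\<close> produces the second factor S.\<close>

lemma mat_trace_q_potential:
  fixes V :: "nat \<Rightarrow> 'a::conjugatable_field mat"
  assumes V: "\<And>i. i < m \<Longrightarrow> V i \<in> carrier_mat l d"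
  shows "mat_trace (q_potential m l V) = mat_trace (frame_op m d V * frame_op m d V)"
proof -
  let ?S = "frame_op m d V"
  have "mat_trace (q_potential m l V) = (\<Sum>j<m. mat_trace (V j * ?S * mat_adjoint (V j)))"
    by (subst q_potential_eq_sum_frame_op[of m V l d], erule V, rule mat_trace_mat_sum)
      (use V in \<open>auto intro!: mult_carrier_mat[of _ l d]\<close>)
  also have "\<dots> = (\<Sum>j<m. mat_trace (?S * (mat_adjoint (V j) * V j)))"
  proof (rule sum.cong[OF refl])
    fix j assume "j \<in> {..<m}"
    then have Vj: "V j \<in> carrier_mat l d" using V by simp
    have "mat_trace (V j * ?S * mat_adjoint (V j)) = mat_trace (V j * (?S * mat_adjoint (V j)))"
      using Vj by (simp add: assoc_mult_mat[of _ l d _ d _ l])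
    also have "\<dots> = mat_trace (?S * mat_adjoint (V j) * V j)"
      using Vj by (intro mat_trace_mult_commute[of _ l d]) (auto intro!: mult_carrier_mat)
    also have "?S * mat_adjoint (V j) * V j = ?S * (mat_adjoint (V j) * V j)"
      using Vj by (simp add: assoc_mult_mat[of _ d d _ l _ d])
    finally show "mat_trace (V j * ?S * mat_adjoint (V j)) = mat_trace (?S * (mat_adjoint (V j) * V j))" .
  qed
  also have "\<dots> = mat_trace (mat_sum d d (\<lambda>j. ?S * (mat_adjoint (V j) * V j)) {..<m})"
    by (rule mat_trace_mat_sum[symmetric], rule mult_carrier_mat[of _ d d],
        simp, rule mult_carrier_mat[of _ d l]) (use V in \<open>auto\<close>)
  \<comment> \<open>Only the last occurrence of the frame operator, the right factor of
    \<open>?S * ?S\<close>, is unfolded into its sum; the others stay as the fixed left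
    factor.\<close>
  also have "mat_sum d d (\<lambda>j. ?S * (mat_adjoint (V j) * V j)) {..<m} = ?S * ?S"
    by (subst (3) frame_op_def, rule mult_mat_sum[symmetric], simp, rule mult_carrier_mat[of _ d l])
      (use V in auto)
  finally show ?thesis .
qed

text \<open>Stacking all the operators \<open>V_i V_j^*\<close> into one tall matrix T exhibits the
  potential as a Gram matrix, hence as positive semidefinite.\<close>

lemma q_potential_eq_adjoint_mult:
  fixes V :: "nat \<Rightarrow> 'a::conjugatable_field mat"
  assumes V: "\<And>i. i < m \<Longrightarrow> V i \<in> carrier_mat l d"
  obtains T where "T \<in> carrier_mat (m * m * l) l" "q_potential m l V = mat_adjoint T * T"
proof
  \<comment> \<open>The single index k encodes the pair (\<open>k div m\<close>,
    \<open>k mod m\<close>), so that T is the analysis operator of a family of \<open>m * m\<close>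
    operators and the identity for frame operators applies.\<close>
  let ?W = "\<lambda>k. V (k div m) * mat_adjoint (V (k mod m))"
  let ?T = "analysis_op (m * m) l l ?W"
  show "?T \<in> carrier_mat (m * m * l) l" by (simp add: analysis_op_def)
  have "\<forall>k<m * m. ?W k \<in> carrier_mat l l"
  proof (intro allI impI)
    fix k assume "k < m * m"
    then have "k div m < m" "k mod m < m"
      by (auto simp: less_mult_imp_div_less intro!: mod_less_divisor gr0I)
    then show "?W k \<in> carrier_mat l l" using V by (auto intro!: mult_carrier_mat)
  qed
  then have "mat_adjoint ?T * ?T = frame_op (m * m) l ?W" by (rule analysis_op_adjoint_mult)
  also have "\<dots> = q_potential m l V"
  proof -
    have "(\<Sum>k<m * m. (mat_adjoint (?W k) * ?W k) $$ ab)
        = (\<Sum>i<m. \<Sum>j<m. abs_square (V i * mat_adjoint (V j)) $$ ab)" for ab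
      using sum_blocks[of "\<lambda>i j. abs_square (V i * mat_adjoint (V j)) $$ ab" m m]
      by (simp add: abs_square_def)
    then show ?thesis
      by (auto simp: frame_op_def q_potential_def mat_sum_def sum.cartesian_product case_prod_beta
        intro!: eq_matI)
  qed
  finally show "q_potential m l V = mat_adjoint ?T * ?T" by simp
qed

section \<open>Unitary diagonalization of Hermitian matrices\<close>

text \<open>The direct sum of the scalar a and X. Indices are split into 0 and successors to fit the
  induction on the matrix size in the spectral theorem.\<close>

definition block_diag :: "'a::zero \<Rightarrow> 'a mat \<Rightarrow> 'a mat" where
  "block_diag a X = mat (Suc (dim_row X)) (Suc (dim_col X))
     (\<lambda>(i, j). case (i, j) of (0, 0) \<Rightarrow> a | (Suc i', Suc j') \<Rightarrow> X $$ (i', j') | _ \<Rightarrow> 0)"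

lemma block_diag_dim [simp]:
  "dim_row (block_diag a X) = Suc (dim_row X)" "dim_col (block_diag a X) = Suc (dim_col X)"
  by (simp_all add: block_diag_def)

lemma block_diag_carrier [simp]:
  "X \<in> carrier_mat n k \<Longrightarrow> block_diag a X \<in> carrier_mat (Suc n) (Suc k)"
  by auto

lemma block_diag_index [simp]:
  "block_diag a X $$ (0, 0) = a"
  "i < dim_row X \<Longrightarrow> block_diag a X $$ (Suc i, 0) = 0"
  "j < dim_col X \<Longrightarrow> block_diag a X $$ (0, Suc j) = 0"
  "i < dim_row X \<Longrightarrow> j < dim_col X \<Longrightarrow> block_diag a X $$ (Suc i, Suc j) = X $$ (i, j)"
  by (simp_all add: block_diag_def)

lemma block_diag_eqI:
  assumes "A \<in> carrier_mat (Suc n) (Suc k)" "X \<in> carrier_mat n k"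
    and "A $$ (0, 0) = a" "\<And>i. i < n \<Longrightarrow> A $$ (Suc i, 0) = 0" "\<And>j. j < k \<Longrightarrow> A $$ (0, Suc j) = 0"
    and "\<And>i j. i < n \<Longrightarrow> j < k \<Longrightarrow> A $$ (Suc i, Suc j) = X $$ (i, j)"
  shows "A = block_diag a X"
proof (rule eq_matI)
  fix i j assume "i < dim_row (block_diag a X)" "j < dim_col (block_diag a X)"
  then show "A $$ (i, j) = block_diag a X $$ (i, j)"
    using assms by (cases i; cases j) auto
qed (use assms in auto)

lemma mult_block_diag:
  fixes X Y :: "'a::semiring_0 mat"
  assumes "X \<in> carrier_mat n k" "Y \<in> carrier_mat k p"
  shows "block_diag a X * block_diag b Y = block_diag (a * b) (X * Y)"
  using assms
  by (intro block_diag_eqI[of _ n p])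
    (auto simp: scalar_prod_def sum.atLeast0_lessThan_Suc_shift intro!: mult_carrier_mat
      simp del: sum.op_ivl_Suc)

lemma mat_adjoint_block_diag: "mat_adjoint (block_diag a X) = block_diag (conjugate a) (mat_adjoint X)"
  by (rule block_diag_eqI[of _ "dim_col X" "dim_row X"]) auto

lemma block_diag_one: "block_diag 1 (1\<^sub>m n) = 1\<^sub>m (Suc n)"
  by (rule block_diag_eqI[symmetric, of _ n n]) auto

lemma block_diag_mat_diag: "block_diag a (mat_diag n f) = mat_diag (Suc n) (case_nat a f)"
  by (rule block_diag_eqI[symmetric, of _ n n]) (auto simp: mat_diag_def)

section \<open>Unitary matrices and the spectral theorem\<close>

lemma mat_adjoint_mat_diag: "mat_adjoint (mat_diag n f) = mat_diag n (\<lambda>i. conjugate (f i))"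
  by (rule eq_matI) (auto simp: mat_diag_def)

lemma unitary_matI:
  assumes "U \<in> carrier_mat n n" "mat_adjoint U * U = 1\<^sub>m n"
  shows "unitary_mat n U"
  using assms mat_mult_left_right_inverse[of "mat_adjoint U" n U] by (simp add: unitary_mat_def)

lemma unitary_mat_mult:
  assumes "unitary_mat n U" "unitary_mat n W"
  shows "unitary_mat n (U * W)"
proof (rule unitary_matI)
  have c: "U \<in> carrier_mat n n" "W \<in> carrier_mat n n" "mat_adjoint U * U = 1\<^sub>m n"
    "mat_adjoint W * W = 1\<^sub>m n"
    using assms by (auto simp: unitary_mat_def)
  then show "U * W \<in> carrier_mat n n" by simp
  have "mat_adjoint (U * W) * (U * W) = mat_adjoint W * (mat_adjoint U * (U * W))"
    using c by (simp add: mat_adjoint_mult[of _ n n] assoc_mult_mat[of _ n n _ n _ n])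
  also have "mat_adjoint U * (U * W) = W"
    using c by (simp add: assoc_mult_mat[of _ n n _ n _ n, symmetric])
  finally show "mat_adjoint (U * W) * (U * W) = 1\<^sub>m n" using c by simp
qed

lemma unitary_mat_cancel:
  assumes "unitary_mat n U" "A \<in> carrier_mat n k"
  shows "mat_adjoint U * (U * A) = A" "U * (mat_adjoint U * A) = A"
  using assms by (auto simp: unitary_mat_def assoc_mult_mat[of _ n n _ n _ k, symmetric])

lemma cscalar_prod_self:
  fixes w :: "complex vec"
  shows "w \<bullet>c w = complex_of_real (\<Sum>i<dim_vec w. (cmod (w $ i))\<^sup>2)"
  by (simp add: scalar_prod_def lessThan_atLeast0 complex_norm_square del: of_real_power)

text \<open>Over the complex numbers the characteristic polynomial splits, so there is an
  eigenvector. It is completed to a basis; Gram-Schmidt keeps the first vector and makes the rest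
  orthogonal to it.\<close>

lemma exists_unitary_first_col_eigenvector:
  fixes A :: "complex mat"
  assumes A: "A \<in> carrier_mat n n" and n: "0 < n"
  obtains W e where "unitary_mat n W" "\<And>i. i < n \<Longrightarrow> (A * W) $$ (i, 0) = e * W $$ (i, 0)"
proof -
  from char_poly_factorized[OF A] obtain as
    where as: "char_poly A = (\<Prod>a\<leftarrow>as. [:- a, 1:])" "length as = n" by blast
  with n obtain e es where "as = e # es" by (cases as) auto
  then have "eigenvalue A e"
    unfolding eigenvalue_root_char_poly[OF A] as by simp
  then obtain v where "eigenvector A v e" by (auto simp: eigenvalue_def)
  then have v: "v \<in> carrier_vec n" "v \<noteq> 0\<^sub>v n" "A *\<^sub>v v = e \<cdot>\<^sub>v v"
    using A by (auto simp: eigenvector_def)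
  interpret cof_vec_space n "TYPE(complex)" .
  define b where "b = basis_completion v"
  define ws where "ws = gram_schmidt n b"
  note bc = basis_completion[OF v(1,2), folded b_def]
  obtain vs where b: "b = v # vs" using bc n by (cases b) auto
  have ws: "set ws \<subseteq> carrier_vec n" "corthogonal ws" "length ws = n"
    using gram_schmidt_result[OF bc(2,4,5) refl, folded ws_def] bc(6) by auto
  have "hd ws = v" using gram_schmidt_hd[OF v(1), of vs, folded b] by (simp add: ws_def)
  then have ws0: "ws ! 0 = v" using ws(3) n by (cases ws) auto
  \<comment> \<open>Gram-Schmidt yields orthogonal but not normalized vectors; \<open>N j\<close> is
    the squared length of the j-th one, and the columns of W are divided by its root.\<close>
  define N where "N j = (\<Sum>k<n. (cmod ((ws ! j) $ k))\<^sup>2)" for j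
  define W where "W = mat n n (\<lambda>(i, j). (ws ! j) $ i / complex_of_real (sqrt (N j)))"
  have dim: "dim_vec (ws ! j) = n" if "j < n" for j
    using that ws(1,3) nth_mem[of j ws] by (auto simp del: nth_mem)
  have N: "complex_of_real (N j) = ws ! j \<bullet>c ws ! j" if "j < n" for j
    using dim[OF that] by (simp add: cscalar_prod_self N_def)
  have "W \<in> carrier_mat n n" by (simp add: W_def)
  moreover have "mat_adjoint W * W = 1\<^sub>m n"
  proof (rule eq_matI)
    fix i j assume "i < dim_row (1\<^sub>m n :: complex mat)" "j < dim_col (1\<^sub>m n :: complex mat)"
    then have ij: "i < n" "j < n" by auto
    have "(mat_adjoint W * W) $$ (i, j) = (\<Sum>k<n. cnj (W $$ (k, i)) * W $$ (k, j))"
      using ij by (simp add: W_def scalar_prod_def lessThan_atLeast0)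
    also have "\<dots> = (ws ! j \<bullet>c ws ! i) / complex_of_real (sqrt (N i) * sqrt (N j))"
      using ij dim by (simp add: W_def scalar_prod_def lessThan_atLeast0 sum_divide_distrib mult.commute)
    also have "\<dots> = 1\<^sub>m n $$ (i, j)"
    proof (cases "i = j")
      case True
      have "N i \<ge> 0" by (simp add: N_def sum_nonneg)
      \<comment> \<open>\<open>corthogonal\<close> includes that no vector of the list is
        zero.\<close>
      moreover have "N i \<noteq> 0" using N[OF ij(1)] corthogonalD[OF ws(2), of i i] ws(3) ij by auto
      ultimately show ?thesis using True ij by (simp add: N[symmetric] del: of_real_mult)
    next
      case False
      then show ?thesis using corthogonalD[OF ws(2), of j i] ws(3) ij by auto
    qed
    finally show "(mat_adjoint W * W) $$ (i, j) = 1\<^sub>m n $$ (i, j)" .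
  qed (auto simp: W_def)
  ultimately have U: "unitary_mat n W" by (rule unitary_matI)
  moreover have "(A * W) $$ (i, 0) = e * W $$ (i, 0)" if i: "i < n" for i
  proof -
    have "(A * W) $$ (i, 0) = (\<Sum>k<n. A $$ (i, k) * v $ k) / complex_of_real (sqrt (N 0))"
      using i n A by (simp add: W_def scalar_prod_def ws0 lessThan_atLeast0 sum_divide_distrib)
    also have "(\<Sum>k<n. A $$ (i, k) * v $ k) = (A *\<^sub>v v) $ i"
      using i A v(1) by (simp add: scalar_prod_def lessThan_atLeast0)
    also have "\<dots> = e * v $ i" using v i by simp
    finally show ?thesis using i n by (simp add: W_def ws0)
  qed
  ultimately show ?thesis by (rule that)
qed

text \<open>Deflation: in a unitary basis that starts with an eigenvector, the first column is a
  multiple of the first unit vector. Hermitian symmetry then clears the first row as well, and the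
  induction hypothesis treats the remaining block.\<close>

theorem hermitian_unitary_diagonalization:
  fixes A :: "complex mat"
  assumes "A \<in> carrier_mat n n" "mat_adjoint A = A"
  shows "\<exists>U \<mu>. unitary_mat n U \<and>
    A = U * mat_diag n (\<lambda>i. complex_of_real (\<mu> i)) * mat_adjoint U"
  using assms
proof (induction n arbitrary: A)
  case 0
  then have "A = 1\<^sub>m 0 * mat_diag 0 (\<lambda>i. complex_of_real 0) * mat_adjoint (1\<^sub>m 0)"
    by (intro eq_matI) auto
  moreover have "unitary_mat 0 (1\<^sub>m 0)" by (rule unitary_matI) auto
  ultimately show ?case by (intro exI[of _ "1\<^sub>m 0"] exI[of _ "\<lambda>_. 0"]) auto
next
  case (Suc n)
  note A = Suc.prems
  obtain W e where W: "unitary_mat (Suc n) W"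
    and We: "\<And>i. i < Suc n \<Longrightarrow> (A * W) $$ (i, 0) = e * W $$ (i, 0)"
    using exists_unitary_first_col_eigenvector[OF A(1)] by auto
  have Wc [simp]: "W \<in> carrier_mat (Suc n) (Suc n)" and WW: "mat_adjoint W * W = 1\<^sub>m (Suc n)"
    using W by (auto simp: unitary_mat_def)
  define B where "B = mat_adjoint W * (A * W)"
  have Bc: "B \<in> carrier_mat (Suc n) (Suc n)"
    using A by (simp add: B_def mult_carrier_mat[of _ "Suc n" "Suc n"])
  have B_herm: "mat_adjoint B = B"
    using A by (simp add: B_def mat_adjoint_mult[of _ "Suc n" "Suc n" _ "Suc n"]
      assoc_mult_mat[of _ "Suc n" "Suc n" _ "Suc n" _ "Suc n"])
  have B_cnj: "B $$ (i, j) = cnj (B $$ (j, i))" if "i < Suc n" "j < Suc n" for i j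
    using arg_cong[OF B_herm, of "\<lambda>X. X $$ (i, j)"] that Bc by simp
  have B_col: "B $$ (i, 0) = (if i = 0 then e else 0)" if i: "i < Suc n" for i
  proof -
    have "B $$ (i, 0) = (\<Sum>k<Suc n. cnj (W $$ (k, i)) * (A * W) $$ (k, 0))"
      using A i carrier_matD[OF Wc]
      by (simp add: B_def scalar_prod_def lessThan_atLeast0 index_mult_mat(1)[of _ "mat_adjoint W"]
          del: sum.op_ivl_Suc sum.lessThan_Suc index_mult_mat(1))
    also have "\<dots> = e * (\<Sum>k<Suc n. cnj (W $$ (k, i)) * W $$ (k, 0))"
      unfolding sum_distrib_left by (rule sum.cong[OF refl]) (simp add: We)
    also have "(\<Sum>k<Suc n. cnj (W $$ (k, i)) * W $$ (k, 0)) = (mat_adjoint W * W) $$ (i, 0)"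
      using i carrier_matD[OF Wc]
      by (simp add: scalar_prod_def lessThan_atLeast0 del: sum.op_ivl_Suc sum.lessThan_Suc)
    finally show ?thesis using i by (simp add: WW)
  qed
  define C where "C = mat n n (\<lambda>(i, j). B $$ (Suc i, Suc j))"
  have Cc: "C \<in> carrier_mat n n" by (simp add: C_def)
  have "mat_adjoint C = C"
    by (rule eq_matI) (auto simp: C_def intro: B_cnj[symmetric])
  then obtain U \<mu> where U: "unitary_mat n U"
    and C: "C = U * mat_diag n (\<lambda>i. complex_of_real (\<mu> i)) * mat_adjoint U"
    using Suc.IH[OF Cc] by blast
  have Uc [simp]: "U \<in> carrier_mat n n" using U by (simp add: unitary_mat_def)
  let ?D = "mat_diag n (\<lambda>i. complex_of_real (\<mu> i))"
  let ?D' = "mat_diag (Suc n) (\<lambda>i. complex_of_real (case_nat (Re e) \<mu> i))"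
  let ?F = "block_diag 1 U"
  have F: "unitary_mat (Suc n) ?F"
    using U
    by (intro unitary_matI) (auto simp: unitary_mat_def mat_adjoint_block_diag
        mult_block_diag[of _ n n _ n] block_diag_one)
  then have Fc: "?F \<in> carrier_mat (Suc n) (Suc n)" by simp
  \<comment> \<open>The eigenvalue is a diagonal entry of a Hermitian matrix, so it equals its own
    conjugate.\<close>
  have e: "e = complex_of_real (Re e)"
    using B_cnj[of 0 0] B_col[of 0] by (auto simp: complex_eq_iff)
  have D': "?D' = block_diag e ?D"
    unfolding block_diag_mat_diag by (subst e) (auto simp: mat_diag_def split: nat.split intro!: eq_matI)
  \<comment> \<open>The entries of the first row are the conjugates of those of the first
    column.\<close>
  have "B = block_diag e C"
    by (rule block_diag_eqI[of _ n n]) (use Bc B_col B_cnj[of 0 "Suc _"] in \<open>auto simp: C_def\<close>)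
  also have "\<dots> = ?F * ?D' * mat_adjoint ?F"
    unfolding D' C by (simp add: mat_adjoint_block_diag mult_block_diag[of _ n n _ n]
      mult_carrier_mat[of _ n n])
  finally have B: "B = ?F * ?D' * mat_adjoint ?F" .
  have "A = W * B * mat_adjoint W"
  proof -
    have "W * B = A * W"
      unfolding B_def using A by (intro unitary_mat_cancel[OF W]) auto
    then have "W * B * mat_adjoint W = A * (W * mat_adjoint W)"
      using A by (simp add: assoc_mult_mat[of _ "Suc n" "Suc n" _ "Suc n" _ "Suc n"])
    then show ?thesis using W A by (simp add: unitary_mat_def)
  qed
  also have "\<dots> = (W * ?F) * ?D' * mat_adjoint (W * ?F)"
    unfolding B using Fc
    by (simp add: mat_adjoint_mult[of _ "Suc n" "Suc n" _ "Suc n"]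
        assoc_mult_mat[of _ "Suc n" "Suc n" _ "Suc n" _ "Suc n"] mult_carrier_mat[of _ "Suc n" "Suc n"])
  finally show ?case using unitary_mat_mult[OF W F] by blast
qed

section \<open>Spectral functions of a diagonalized matrix\<close>

text \<open>Shaped like the condition under \<open>THE\<close> in
  \<open>functional_calculus\<close>, so that it can be folded there. The values
  \<open>\<mu>\<close> come in no particular order.\<close>

definition diagonalized_by :: "nat \<Rightarrow> complex mat \<Rightarrow> complex mat \<Rightarrow> (nat \<Rightarrow> real) \<Rightarrow> bool" where
  "diagonalized_by n A U \<mu> \<longleftrightarrow>
     unitary_mat n U \<and> A = U * mat_diag n (\<lambda>i. complex_of_real (\<mu> i)) * mat_adjoint U"

lemma diagonalized_byD:
  assumes "diagonalized_by n A U \<mu>"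
  shows "U \<in> carrier_mat n n" "A \<in> carrier_mat n n" "dim_row A = n"
    "mat_adjoint U * U = 1\<^sub>m n" "U * mat_adjoint U = 1\<^sub>m n"
    "A = U * mat_diag n (\<lambda>i. complex_of_real (\<mu> i)) * mat_adjoint U"
  using assms by (auto simp: diagonalized_by_def unitary_mat_def intro!: mult_carrier_mat[of _ n n])

lemma diagonalized_by_conj:
  assumes "diagonalized_by n A U \<mu>"
  shows "mat_adjoint U * A * U = mat_diag n (\<lambda>i. complex_of_real (\<mu> i))"
proof -
  note d = diagonalized_byD[OF assms]
  let ?D = "mat_diag n (\<lambda>i. complex_of_real (\<mu> i))"
  have u: "unitary_mat n U" using assms by (simp add: diagonalized_by_def)
  have "mat_adjoint U * A * U = mat_adjoint U * (U * (?D * (mat_adjoint U * U)))"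
    unfolding d(6) using d(1)
    by (simp add: assoc_mult_mat[of _ n n _ n _ n] mult_carrier_mat[of _ n n] del: mat_diag_diag)
  also have "\<dots> = ?D" using d(1,4)
    by (simp add: right_mult_one_mat[of _ n n] unitary_mat_cancel[OF u, of _ n])
  finally show ?thesis .
qed

lemma proots_prod_list_linear:
  "proots (\<Prod>a\<leftarrow>as. [:- a, 1:]) = mset (as :: 'a::idom list)"
proof (induction as)
  case (Cons a as)
  have "(\<Prod>a\<leftarrow>as. [:- a, 1:]) \<noteq> 0" by (auto simp: prod_list_zero_iff)
  then show ?case using Cons by (simp add: proots_mult del: mult_pCons_left)
qed simp

text \<open>Similar matrices share the characteristic polynomial, and that of a diagonal matrix
  factors over its diagonal, so its roots with multiplicity are the \<open>\<mu> i\<close>.\<close>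

lemma eigenvalue_vec_diagonalized:
  assumes "diagonalized_by n A U \<mu>"
  shows "eigenvalue_vec A = vec_of_list (rev (sort (map \<mu> [0..<n])))"
proof -
  note d = diagonalized_byD[OF assms]
  let ?D = "mat_diag n (\<lambda>i. complex_of_real (\<mu> i))"
  have "similar_mat_wit A ?D U (mat_adjoint U)"
    using d by (intro similar_mat_witI[of _ _ n]) auto
  then have "char_poly A = char_poly ?D"
    by (intro char_poly_similar) (auto simp: similar_mat_def)
  also have "\<dots> = (\<Prod>a\<leftarrow>diag_mat ?D. [:- a, 1:])"
    by (rule char_poly_upper_triangular[of _ n]) (auto simp: mat_diag_def)
  also have "diag_mat ?D = map (\<lambda>i. complex_of_real (\<mu> i)) [0..<n]"
    by (auto simp: diag_mat_def mat_diag_def)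
  finally have "proots (char_poly A) = mset (map (\<lambda>i. complex_of_real (\<mu> i)) [0..<n])"
    by (simp only: proots_prod_list_linear)
  then have "image_mset Re (proots (char_poly A)) = mset (map \<mu> [0..<n])"
    by (simp add: multiset.map_comp comp_def)
  then show ?thesis
    by (simp only: eigenvalue_vec_def sorted_list_of_multiset_mset)
qed

lemma mat_trace_diagonalized:
  assumes "diagonalized_by n A U \<mu>"
  shows "mat_trace A = complex_of_real (\<Sum>i<n. \<mu> i)"
proof -
  note d = diagonalized_byD[OF assms]
  have "mat_trace A = mat_trace (mat_adjoint U * (A * U))"
  proof -
    have "mat_trace (mat_adjoint U * (A * U)) = mat_trace (A * U * mat_adjoint U)"
      using d(1,2) by (intro mat_trace_mult_commute[of _ n n]) auto
    also have "A * U * mat_adjoint U = A"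
      using d(1,2,5) by (simp add: assoc_mult_mat[of A n n U n _ n])
    finally show ?thesis by simp
  qed
  also have "mat_adjoint U * (A * U) = mat_diag n (\<lambda>i. complex_of_real (\<mu> i))"
    using d(1,2) diagonalized_by_conj[OF assms] by (simp add: assoc_mult_mat[of _ n n A n U n])
  finally show ?thesis by (simp add: mat_trace_def mat_diag_def)
qed

text \<open>
  For two diagonalizations of \<open>A\<close>, the matrix \<open>X = W\<^sup>* U\<close> intertwines the two diagonal matrices:
  \<open>X\<^sub>i\<^sub>j \<noteq> 0\<close> forces \<open>\<mu>\<^sub>j = \<nu>\<^sub>i\<close>, so that \<open>X\<close> also intertwines their images under \<open>f\<close>.
\<close>

lemma functional_calculus_unique:
  assumes U: "diagonalized_by n A U \<mu>" and W: "diagonalized_by n A W \<nu>"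
  shows "U * mat_diag n (\<lambda>i. complex_of_real (f (\<mu> i))) * mat_adjoint U
    = W * mat_diag n (\<lambda>i. complex_of_real (f (\<nu> i))) * mat_adjoint W"
proof -
  note u = diagonalized_byD[OF U] and w = diagonalized_byD[OF W]
  have uu: "unitary_mat n U" "unitary_mat n W" using U W by (auto simp: diagonalized_by_def)
  note [simp] = u(1) w(1)
  let ?D = "\<lambda>g. mat_diag n (\<lambda>i. complex_of_real (g i))"
  define X where "X = mat_adjoint W * U"
  have X: "X \<in> carrier_mat n n" by (simp add: X_def mult_carrier_mat[of _ n n])
  have assoc: "P * Q * R = P * (Q * R)"
    if "P \<in> carrier_mat n n" "Q \<in> carrier_mat n n" "R \<in> carrier_mat n n" for P Q R :: "complex mat"
    using that by (rule assoc_mult_mat)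
  have "A * U = U * ?D \<mu>"
    unfolding u(6) using u(4) by (simp add: assoc right_mult_one_mat[of _ n n] mult_carrier_mat[of _ n n])
  then have "X * ?D \<mu> = mat_adjoint W * (A * U)"
    by (simp add: X_def assoc)
  also have "\<dots> = ?D \<nu> * X"
    using w(4)
    by (simp add: w(6) X_def assoc mult_carrier_mat[of _ n n] unitary_mat_cancel[OF uu(2), of _ n])
  finally have comm: "X * ?D \<mu> = ?D \<nu> * X" .
  have "X * ?D (\<lambda>i. f (\<mu> i)) = ?D (\<lambda>i. f (\<nu> i)) * X"
  proof (rule eq_matI)
    fix i j assume "i < dim_row (?D (\<lambda>i. f (\<nu> i)) * X)" "j < dim_col (?D (\<lambda>i. f (\<nu> i)) * X)"
    then have ij: "i < n" "j < n" using X by (auto simp: mat_diag_def)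
    have "X $$ (i, j) * complex_of_real (\<mu> j) = complex_of_real (\<nu> i) * X $$ (i, j)"
      using arg_cong[OF comm, of "\<lambda>M. M $$ (i, j)"] X ij
      by (simp add: mat_diag_mult_left[OF X] mat_diag_mult_right[OF X])
    then have "X $$ (i, j) = 0 \<or> \<mu> j = \<nu> i" by auto
    then show "(X * ?D (\<lambda>i. f (\<mu> i))) $$ (i, j) = (?D (\<lambda>i. f (\<nu> i)) * X) $$ (i, j)"
      using X ij by (auto simp: mat_diag_mult_left[OF X] mat_diag_mult_right[OF X])
  qed (use X in \<open>auto simp: mat_diag_def\<close>)
  then have "W * (X * ?D (\<lambda>i. f (\<mu> i))) * mat_adjoint U = W * (?D (\<lambda>i. f (\<nu> i)) * X) * mat_adjoint U"
    by simp
  then show ?thesis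
    using u(5)
    by (simp add: X_def assoc right_mult_one_mat[of _ n n] mult_carrier_mat[of _ n n]
        unitary_mat_cancel[OF uu(2), of _ n])
qed

text \<open>All diagonalizations yield the same matrix, so the \<open>THE\<close> in the definition
  denotes the one computed from U and \<open>\<mu>\<close>.\<close>

lemma functional_calculus_diagonalized:
  assumes "diagonalized_by n A U \<mu>"
  shows "diagonalized_by n (functional_calculus f A) U (\<lambda>i. f (\<mu> i))"
proof -
  note d = diagonalized_byD[OF assms]
  let ?B = "U * mat_diag n (\<lambda>i. complex_of_real (f (\<mu> i))) * mat_adjoint U"
  have "functional_calculus f A = ?B"
    unfolding functional_calculus_def d(3) diagonalized_by_def[symmetric] conj_assoc[symmetric]
  proof (rule the_equality)
    show "\<exists>W \<nu>. diagonalized_by n A W \<nu> \<and>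
        ?B = W * mat_diag n (\<lambda>i. complex_of_real (f (\<nu> i))) * mat_adjoint W"
      using assms by blast
    show "B = ?B" if "\<exists>W \<nu>. diagonalized_by n A W \<nu> \<and>
        B = W * mat_diag n (\<lambda>i. complex_of_real (f (\<nu> i))) * mat_adjoint W" for B
      using that by (elim exE conjE) (simp only: functional_calculus_unique[OF _ assms])
  qed
  then show ?thesis using assms by (simp add: diagonalized_by_def)
qed

text \<open>Conjugating by U turns the Gram matrix of T into that of \<open>T * U\<close>, so
  \<open>\<mu> i\<close> is the squared length of the i-th column of \<open>T * U\<close>.\<close>

lemma diagonalized_nonneg:
  assumes "diagonalized_by n (mat_adjoint T * T) U \<mu>" "T \<in> carrier_mat k n" "i < n"
  shows "0 \<le> \<mu> i"
proof -
  note d = diagonalized_byD[OF assms(1)]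
  let ?Y = "T * U"
  have Y: "?Y \<in> carrier_mat k n" using assms(2) d(1) by simp
  have "mat_adjoint U * (mat_adjoint T * T) * U = mat_adjoint U * (mat_adjoint T * (T * U))"
    using d(1) assms(2)
    by (simp add: assoc_mult_mat[of _ n n _ n _ n] assoc_mult_mat[of _ n k _ n _ n]
        mult_carrier_mat[of _ n k] mult_carrier_mat[of _ k n])
  also have "\<dots> = mat_adjoint ?Y * ?Y"
    using d(1) assms(2) by (simp add: mat_adjoint_mult[of _ k n _ n] assoc_mult_mat[of _ n n _ k _ n])
  finally have "complex_of_real (\<mu> i) = (mat_adjoint ?Y * ?Y) $$ (i, i)"
    using arg_cong[OF diagonalized_by_conj[OF assms(1)], of "\<lambda>M. M $$ (i, i)"] assms(3)
    by (simp add: mat_diag_def)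
  also have "\<dots> = complex_of_real (\<Sum>r<k. (cmod (?Y $$ (r, i)))\<^sup>2)"
    by (rule mat_adjoint_mult_self_index[OF Y assms(3)])
  finally have "\<mu> i = (\<Sum>r<k. (cmod (?Y $$ (r, i)))\<^sup>2)" by (simp only: of_real_eq_iff)
  then show ?thesis by (simp add: sum_nonneg)
qed

lemma adjoint_mult_diagonalized:
  assumes "diagonalized_by n A U \<mu>"
  shows "diagonalized_by n (mat_adjoint A * A) U (\<lambda>i. (\<mu> i)\<^sup>2)"
proof -
  note d = diagonalized_byD[OF assms]
  have uu: "unitary_mat n U" using assms by (auto simp: diagonalized_by_def)
  let ?D = "mat_diag n (\<lambda>i. complex_of_real (\<mu> i))"
  have "mat_adjoint A = A"
    unfolding d(6) using d(1)
    by (simp add: mat_adjoint_mult[of _ n n _ n] mat_adjoint_mat_diag assoc_mult_mat[of _ n n _ n _ n]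
      mult_carrier_mat[of _ n n])
  moreover have "A * A = U * (?D * ?D) * mat_adjoint U"
    unfolding d(6) using d(1)
    by (simp add: assoc_mult_mat[of _ n n _ n _ n] mult_carrier_mat[of _ n n]
      unitary_mat_cancel[OF uu, of _ n] del: mat_diag_diag)
  ultimately show ?thesis
    using assms by (simp add: diagonalized_by_def power2_eq_square)
qed

lemma sort_map_mono_on:
  assumes "mono_on (set xs) f"
  shows "sort (map f xs) = map f (sort xs)"
proof -
  have "sorted (map f (sort xs))"
    using assms by (auto simp: sorted_map intro!: sorted_wrt_mono_rel[OF _ sorted_sort] mono_onD[OF assms])
  then show ?thesis by (intro properties_for_sort) auto
qed

text \<open>A is Hermitian, so \<open>mat_adjoint A * A\<close> has the eigenvalues
  \<open>(\<mu> i)\<^sup>2\<close>; nonnegativity makes their roots the \<open>\<mu> i\<close>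
  again, and the monotone root commutes with sorting.\<close>

lemma singular_value_vec_diagonalized:
  assumes "diagonalized_by n A U \<mu>" "\<And>i. i < n \<Longrightarrow> 0 \<le> \<mu> i"
  shows "singular_value_vec A = vec_of_list (rev (sort (map \<mu> [0..<n])))"
proof -
  have "map \<mu> [0..<n] = map sqrt (map (\<lambda>i. (\<mu> i)\<^sup>2) [0..<n])"
    using assms(2) by simp
  also have "sort \<dots> = map sqrt (sort (map (\<lambda>i. (\<mu> i)\<^sup>2) [0..<n]))"
    by (rule sort_map_mono_on) (simp add: mono_on_def)
  finally show ?thesis
    unfolding singular_value_vec_def
      eigenvalue_vec_diagonalized[OF adjoint_mult_diagonalized[OF assms(1)]]
    by (simp add: vec_of_list_map rev_map)
qed

section \<open>Comparison of a vector with its mean\<close>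

lemma mod_add_bij:
  fixes i l :: nat
  assumes l: "0 < l"
  shows "bij_betw (\<lambda>k. (i + k) mod l) {..<l} {..<l}"
proof -
  have "inj_on (\<lambda>k. (i + k) mod l) {..<l}"
  proof (rule inj_onI)
    fix j k assume jk: "j \<in> {..<l}" "k \<in> {..<l}" "(i + j) mod l = (i + k) mod l"
    then have "[i + j = i + k] (mod l)" by (simp add: cong_def)
    then have "[j = k] (mod l)" by (simp add: cong_add_lcancel_nat)
    then show "j = k" using jk by (simp add: cong_def)
  qed
  moreover have "(\<lambda>k. (i + k) mod l) ` {..<l} \<subseteq> {..<l}" using l by auto
  ultimately show ?thesis by (simp add: bij_betw_def endo_inj_surj)
qed

lemma symmetric_gauge_sum_le:
  assumes "symmetric_gauge l \<psi>" "finite K" "K \<noteq> {}" "\<And>k. k \<in> K \<Longrightarrow> v k \<in> carrier_vec l"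
  shows "\<psi> (vec l (\<lambda>i. \<Sum>k\<in>K. v k $ i)) \<le> (\<Sum>k\<in>K. \<psi> (v k))"
  using assms(2,3,4)
proof (induction K rule: finite_ne_induct)
  case (singleton k)
  then have "vec l (\<lambda>i. v k $ i) = v k" by auto
  then show ?case by simp
next
  case (insert k K)
  let ?s = "vec l (\<lambda>i. \<Sum>k\<in>K. v k $ i)"
  have "vec l (\<lambda>i. \<Sum>k\<in>insert k K. v k $ i) = v k + ?s"
    using insert by (intro eq_vecI) auto
  moreover have "\<psi> (v k + ?s) \<le> \<psi> (v k) + \<psi> ?s"
    using assms(1) insert.prems[of k] by (auto simp: symmetric_gauge_def)
  ultimately show ?case using insert by force
qed

text \<open>Averaging \<open>x\<close> over its cyclic shifts gives the constant vector of its mean.\<close>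

lemma symmetric_gauge_mean_le:
  assumes gauge: "symmetric_gauge l \<psi>" and l: "0 < l" and x: "x \<in> carrier_vec l"
  shows "\<psi> (vec l (\<lambda>_. 1)) * ((\<Sum>i<l. x $ i) / real l) \<le> \<psi> x"
proof -
  let ?s = "\<Sum>i<l. x $ i"
  let ?v = "\<lambda>k. vec l (\<lambda>i. x $ ((i + k) mod l))"
  have shift: "\<psi> (?v k) = \<psi> x" for k
  proof -
    \<comment> \<open>The shift is extended by the identity, since \<open>permutes\<close> demands
      fixed points outside the index set.\<close>
    let ?p = "\<lambda>i. if i < l then (i + k) mod l else i"
    have "bij_betw ?p {..<l} {..<l}"
      using mod_add_bij[OF l, of k] by (rule bij_betw_cong[THEN iffD1, rotated]) (simp add: add.commute)
    then have "?p permutes {..<l}" by (rule bij_imp_permutes) auto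
    then have "\<psi> (vec l (\<lambda>i. x $ ?p i)) = \<psi> x"
      using gauge x by (simp add: symmetric_gauge_def)
    moreover have "vec l (\<lambda>i. x $ ?p i) = ?v k" by auto
    ultimately show ?thesis by simp
  qed
  \<comment> \<open>At a fixed coordinate, the l shifts run through every entry of x exactly
    once.\<close>
  have "vec l (\<lambda>i. \<Sum>k<l. ?v k $ i) = ?s \<cdot>\<^sub>v vec l (\<lambda>_. 1)"
    using sum.reindex_bij_betw[OF mod_add_bij[OF l], of "\<lambda>j. x $ j"] by (auto intro!: eq_vecI)
  moreover have "\<psi> (?s \<cdot>\<^sub>v vec l (\<lambda>_. 1)) = \<bar>?s\<bar> * \<psi> (vec l (\<lambda>_. 1))"
    using gauge by (simp add: symmetric_gauge_def)
  ultimately have "\<bar>?s\<bar> * \<psi> (vec l (\<lambda>_. 1)) \<le> real l * \<psi> x"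
    using symmetric_gauge_sum_le[OF gauge, of "{..<l}" ?v] l by (simp add: shift lessThan_empty_iff)
  \<comment> \<open>Homogeneity yields the absolute value of the sum, which dominates the sum
    itself.\<close>
  moreover have "0 \<le> \<psi> (vec l (\<lambda>_. 1))" using gauge by (simp add: symmetric_gauge_def)
  then have "?s * \<psi> (vec l (\<lambda>_. 1)) \<le> \<bar>?s\<bar> * \<psi> (vec l (\<lambda>_. 1))" by (intro mult_right_mono) auto
  ultimately have "?s * \<psi> (vec l (\<lambda>_. 1)) \<le> real l * \<psi> x" by linarith
  then show ?thesis using l by (simp add: field_simps)
qed

lemma symmetric_gauge_one_pos:
  assumes "symmetric_gauge l \<psi>" "0 < l"
  shows "0 < \<psi> (vec l (\<lambda>_. 1))"
proof -
  have "vec l (\<lambda>_. 1) \<noteq> (0\<^sub>v l :: real vec)"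
    using assms(2) by (auto dest!: arg_cong[of _ _ "\<lambda>v. v $ 0"])
  then show ?thesis
    using assms(1) unfolding symmetric_gauge_def
    by (elim conjE ballE[of _ _ "vec l (\<lambda>_. 1)"]) auto
qed

text \<open>Each of the \<open>l - k\<close> tail entries is at most each of the k head entries;
  adding up all these pairs compares the averages, here cleared of denominators.\<close>

lemma antimono_sum_prefix_ge:
  fixes x :: "nat \<Rightarrow> real"
  assumes anti: "\<And>i j. i \<le> j \<Longrightarrow> j < l \<Longrightarrow> x j \<le> x i" and k: "k \<le> l"
  shows "real k * (\<Sum>i<l. x i) \<le> real l * (\<Sum>i<k. x i)"
proof -
  have "(\<Sum>i<l. x i) = (\<Sum>i<k. x i) + (\<Sum>i\<in>{k..<l}. x i)"
    using sum.atLeastLessThan_concat[of 0 k l x] k by (simp add: lessThan_atLeast0)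
  moreover have "real k * (\<Sum>i\<in>{k..<l}. x i) \<le> real (l - k) * (\<Sum>i<k. x i)"
  proof -
    have "real k * (\<Sum>i\<in>{k..<l}. x i) = (\<Sum>i<k. \<Sum>j\<in>{k..<l}. x j)" by simp
    also have "\<dots> \<le> (\<Sum>i<k. \<Sum>j\<in>{k..<l}. x i)"
      using anti by (intro sum_mono) auto
    also have "\<dots> = real (l - k) * (\<Sum>i<k. x i)" by (simp add: sum_distrib_left)
    finally show ?thesis .
  qed
  ultimately show ?thesis using k by (simp add: of_nat_diff algebra_simps)
qed

section \<open>Sorted lists and submajorization of a constant vector\<close>

lemma decreasing_rearrangement_rev_sort:
  "decreasing_rearrangement (vec_of_list (rev (sort xs))) = vec_of_list (rev (sort xs))"
proof -
  have "sort (rev (sort xs)) = sort xs" by (intro properties_for_sort) auto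
  then show ?thesis by (simp add: decreasing_rearrangement_def list_vec)
qed

lemma sum_vec_of_list: "length xs = n \<Longrightarrow> (\<Sum>i<n. vec_of_list xs $ i) = sum_list xs"
  by (simp add: sum_list_sum_nth lessThan_atLeast0 vec_of_list_index)

lemma sum_list_sort_map_upt: "sum_list (sort (map \<mu> [0..<n])) = (\<Sum>i<n. \<mu> i :: real)"
proof -
  have "sum_list (sort (map \<mu> [0..<n])) = sum_list (map \<mu> [0..<n])"
    by (simp flip: sum_mset_sum_list)
  then show ?thesis by (simp add: interv_sum_list_conv_sum_set_nat lessThan_atLeast0)
qed

lemma rev_sort_replicate: "rev (sort (replicate n c)) = replicate n (c::real)"
  by (simp add: sorted_sort_id)

lemma submajorized_mean:
  assumes c: "real n * c \<le> (\<Sum>i<n. \<mu> i)"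
  shows "submajorized (vec_of_list (replicate n c)) (vec_of_list (rev (sort (map \<mu> [0..<n]))))"
proof -
  let ?ys = "rev (sort (map \<mu> [0..<n]))"
  have "(\<Sum>i<k. replicate n c ! i) \<le> (\<Sum>i<k. ?ys ! i)" if k: "1 \<le> k" "k \<le> n" for k
  proof -
    have "real k * (\<Sum>i<n. ?ys ! i) \<le> real n * (\<Sum>i<k. ?ys ! i)"
    proof (rule antimono_sum_prefix_ge[OF _ k(2)])
      fix i j assume "i \<le> j" "j < n"
      then show "?ys ! j \<le> ?ys ! i"
        by (auto simp: rev_nth intro!: sorted_nth_mono)
    qed
    moreover have "(\<Sum>i<n. ?ys ! i) = (\<Sum>i<n. \<mu> i)"
      using sum_list_sum_nth[of ?ys] sum_list_sort_map_upt[of \<mu> n] by (simp add: lessThan_atLeast0)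
    moreover have "real k * (real n * c) \<le> real k * (\<Sum>i<n. \<mu> i)"
      using c by (intro mult_left_mono) auto
    \<comment> \<open>The factor n cancels afterwards because \<open>1 \<le> k\<close> and
      \<open>k \<le> n\<close> make it positive.\<close>
    ultimately have "real n * (real k * c) \<le> real n * (\<Sum>i<k. ?ys ! i)"
      by (simp add: algebra_simps)
    then show ?thesis using k by simp
  qed
  moreover have "decreasing_rearrangement (vec_of_list (replicate n c)) = vec_of_list (replicate n c)"
    using decreasing_rearrangement_rev_sort[of "replicate n c"] by (simp add: rev_sort_replicate)
  ultimately show ?thesis
    by (simp add: submajorized_def decreasing_rearrangement_rev_sort vec_of_list_index)
qed

section \<open>Convex functions on the nonnegative reals\<close>

lemma convex_on_mean_le:
  fixes \<mu> :: "nat \<Rightarrow> real"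
  assumes "convex_on {0..} f" "0 < n" "\<And>i. i < n \<Longrightarrow> 0 \<le> \<mu> i"
  shows "real n * f ((\<Sum>i<n. \<mu> i) / real n) \<le> (\<Sum>i<n. f (\<mu> i))"
proof -
  have "f (\<Sum>i<n. (1 / real n) *\<^sub>R \<mu> i) \<le> (\<Sum>i<n. (1 / real n) * f (\<mu> i))"
    using assms by (intro convex_on_sum[of _ "{0..}"]) auto
  then show ?thesis
    using assms(2) by (simp add: sum_divide_distrib[symmetric] field_simps)
qed

text \<open>If f took the same value at x and y, strict convexity would put the midpoint value below
  \<open>f x\<close>, against monotonicity.\<close>

lemma strictly_convex_mono_imp_strict_mono:
  assumes "mono_on {0..} f" "strictly_convex_on {0..} f" "0 \<le> x" "x < y"
  shows "f x < f (y::real)"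
proof (rule ccontr)
  assume "\<not> f x < f y"
  moreover have "f x \<le> f y" using assms by (auto intro: mono_onD)
  ultimately have eq: "f x = f y" by simp
  have "f ((1 - 1/2) * x + 1/2 * y) < (1 - 1/2) * f x + 1/2 * f y"
    using assms(2-4) unfolding strictly_convex_on_def
    by (elim conjE ballE[of _ _ x] ballE[of _ _ y] allE[of _ "1/2"]) auto
  also have "\<dots> = f x" using eq by simp
  finally show False
    using mono_onD[OF assms(1), of x "(1 - 1/2) * x + 1/2 * y"] assms(3,4) by simp
qed

lemma strictly_convex_on_imp_convex_on:
  assumes "strictly_convex_on S f"
  shows "convex_on S f"
proof (rule convex_onI)
  fix t x y :: real assume "0 < t" "t < 1" "x \<in> S" "y \<in> S"
  then show "f ((1 - t) *\<^sub>R x + t *\<^sub>R y) \<le> (1 - t) * f x + t * f y"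
    using assms unfolding strictly_convex_on_def
    by (cases "x = y") (simp add: algebra_simps, auto intro: less_imp_le)
qed (use assms in \<open>simp add: strictly_convex_on_def\<close>)

section \<open>Matrices over the real or complex field\<close>

lemma to_complex_0 [simp]: "to_complex (0 :: 'k::real_or_complex) = 0"
  using to_complex_add[of "0 :: 'k" 0] by simp

text \<open>The image of 1 is idempotent, and injectivity keeps it from being 0.\<close>

lemma to_complex_1 [simp]: "to_complex (1 :: 'k::real_or_complex) = 1"
proof -
  have "to_complex (1 :: 'k) * to_complex (1 :: 'k) = to_complex (1 :: 'k)"
    by (simp flip: to_complex_mult)
  moreover have "to_complex (1 :: 'k) \<noteq> 0"
    using to_complex_eq_iff[of "1 :: 'k" 0] by simp
  ultimately show ?thesis by simp
qed

lemma to_complex_sum: "to_complex (\<Sum>i\<in>I. f i :: 'k::real_or_complex) = (\<Sum>i\<in>I. to_complex (f i))"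
  by (induction I rule: infinite_finite_induct) (simp_all add: to_complex_add)

abbreviation complexify :: "'k::real_or_complex mat \<Rightarrow> complex mat" where
  "complexify \<equiv> map_mat to_complex"

lemma complexify_eq_iff: "complexify A = complexify B \<longleftrightarrow> A = B"
  by (auto simp: mat_eq_iff to_complex_eq_iff)

lemma complexify_mult:
  assumes "A \<in> carrier_mat n k" "B \<in> carrier_mat k p"
  shows "complexify (A * B) = complexify A * complexify B"
  using assms
  by (intro eq_matI) (auto simp: scalar_prod_def to_complex_sum to_complex_mult)

lemma complexify_adjoint: "complexify (mat_adjoint A) = mat_adjoint (complexify A)"
  by (rule eq_matI) (auto simp: to_complex_conjugate)

lemma complexify_one: "complexify (1\<^sub>m n) = 1\<^sub>m n"
  by (rule eq_matI) auto

lemma complexify_mat_sum: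
  assumes "\<And>i. i \<in> I \<Longrightarrow> F i \<in> carrier_mat nr nc"
  shows "complexify (mat_sum nr nc F I) = mat_sum nr nc (\<lambda>i. complexify (F i)) I"
proof (rule eq_matI)
  fix a b assume "a < dim_row (mat_sum nr nc (\<lambda>i. complexify (F i)) I)"
    "b < dim_col (mat_sum nr nc (\<lambda>i. complexify (F i)) I)"
  then have ab: "a < nr" "b < nc" by (auto simp: mat_sum_def)
  have "to_complex (F i $$ (a, b)) = complexify (F i) $$ (a, b)" if "i \<in> I" for i
    using assms[OF that] ab by simp
  then show "complexify (mat_sum nr nc F I) $$ (a, b) = mat_sum nr nc (\<lambda>i. complexify (F i)) I $$ (a, b)"
    using ab by (simp add: mat_sum_def to_complex_sum)
qed (auto simp: mat_sum_def)

lemma mat_trace_complexify: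
  assumes "A \<in> carrier_mat n n"
  shows "mat_trace (complexify A) = to_complex (mat_trace A)"
  using assms by (auto simp: mat_trace_def to_complex_sum)

text \<open>The embedding commutes with products, adjoints and sums. This lets the Gram
  factorization be applied to the complexified family, so that the spectral theorem becomes
  available over both scalar fields.\<close>

lemma q_potential_complex_eq:
  assumes V: "\<And>i. i < m \<Longrightarrow> V i \<in> carrier_mat l d"
  shows "q_potential_complex m l V = q_potential m l (\<lambda>i. complexify (V i))"
proof -
  have c: "abs_square (V i * mat_adjoint (V j)) \<in> carrier_mat l l"
    "complexify (abs_square (V i * mat_adjoint (V j)))
      = abs_square (complexify (V i) * mat_adjoint (complexify (V j)))" if "i < m" "j < m" for i j
  proof -
    have p: "V i * mat_adjoint (V j) \<in> carrier_mat l l"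
      using that V by (auto intro!: mult_carrier_mat[of _ l d])
    then show "abs_square (V i * mat_adjoint (V j)) \<in> carrier_mat l l"
      by (simp add: abs_square_def mult_carrier_mat[of _ l l])
    show "complexify (abs_square (V i * mat_adjoint (V j)))
        = abs_square (complexify (V i) * mat_adjoint (complexify (V j)))"
      using p that V
      by (simp add: abs_square_def complexify_mult[of _ l l _ l] complexify_mult[of _ l d _ l]
          complexify_adjoint)
  qed
  have "q_potential_complex m l V = mat_sum l l
      (\<lambda>p. complexify (case p of (i, j) \<Rightarrow> abs_square (V i * mat_adjoint (V j)))) ({..<m} \<times> {..<m})"
    unfolding q_potential_complex_def q_potential_def
    by (rule complexify_mat_sum) (use c(1) in auto)
  also have "\<dots> = q_potential m l (\<lambda>i. complexify (V i))"
    unfolding q_potential_def by (rule mat_sum_cong) (use c(2) in auto)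
  finally show ?thesis .
qed

text \<open>After embedding into the complex matrices, each diagonal entry of the Gram matrix is the
  squared length of a column of A.\<close>

lemma mat_adjoint_mult_self_eq_0:
  fixes A :: "'k::real_or_complex mat"
  assumes A: "A \<in> carrier_mat n k" and 0: "mat_adjoint A * A = 0\<^sub>m k k"
  shows "A = 0\<^sub>m n k"
proof (rule eq_matI)
  fix i j assume "i < dim_row (0\<^sub>m n k :: 'k mat)" "j < dim_col (0\<^sub>m n k :: 'k mat)"
  then have ij: "i < n" "j < k" by auto
  let ?B = "complexify A"
  have "mat_adjoint ?B * ?B = complexify (mat_adjoint A * A)"
    using A by (simp add: complexify_mult[of _ k n _ k] complexify_adjoint)
  then have "(mat_adjoint ?B * ?B) $$ (j, j) = 0" using ij by (simp add: 0)
  then have "(\<Sum>i<n. (cmod (?B $$ (i, j)))\<^sup>2) = 0"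
    using mat_adjoint_mult_self_index[of ?B n k j] A ij by (simp only: map_carrier_mat of_real_eq_0_iff)
  then have "to_complex (A $$ (i, j)) = 0" using A ij by (simp add: sum_nonneg_eq_0_iff)
  then show "A $$ (i, j) = 0\<^sub>m n k $$ (i, j)"
    using ij to_complex_eq_iff[of "A $$ (i, j)" 0] by simp
qed (use A in auto)

text \<open>Expanding \<open>tr (S - I)\<^sup>*(S - I)\<close>.\<close>

lemma mat_trace_square_hermitian:
  fixes S :: "complex mat"
  assumes S: "S \<in> carrier_mat d d" and herm: "mat_adjoint S = S"
  shows "mat_trace (S * S) = complex_of_real
    (2 * Re (mat_trace S) - real d + (\<Sum>b<d. \<Sum>a<d. (cmod (S $$ (a, b) - 1\<^sub>m d $$ (a, b)))\<^sup>2))"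
proof -
  have "mat_trace (S * S) = (\<Sum>b<d. (mat_adjoint S * S) $$ (b, b))"
    using S by (simp add: herm mat_trace_def)
  also have "\<dots> = complex_of_real (\<Sum>b<d. \<Sum>a<d. (cmod (S $$ (a, b)))\<^sup>2)"
    using mat_adjoint_mult_self_index[OF S] by simp
  also have "(\<Sum>a<d. (cmod (S $$ (a, b)))\<^sup>2) = 2 * Re (S $$ (b, b)) - 1 +
      (\<Sum>a<d. (cmod (S $$ (a, b) - 1\<^sub>m d $$ (a, b)))\<^sup>2)" if b: "b < d" for b
  proof -
    \<comment> \<open>Needed only for the diagonal entry of each column; off the diagonal the
      identity matrix contributes 0 and the two moduli agree.\<close>
    have sq: "(cmod z)\<^sup>2 = (cmod (z - 1))\<^sup>2 + (2 * Re z - 1)" for z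
      unfolding cmod_power2 by (simp add: power2_eq_square algebra_simps)
    have "(cmod (S $$ (a, b)))\<^sup>2 = (cmod (S $$ (a, b) - 1\<^sub>m d $$ (a, b)))\<^sup>2
        + (if a = b then 2 * Re (S $$ (b, b)) - 1 else 0)" if "a < d" for a
      using b that sq[of "S $$ (b, b)"] by (cases "a = b") simp_all
    then have "(\<Sum>a<d. (cmod (S $$ (a, b)))\<^sup>2) = (\<Sum>a<d. (cmod (S $$ (a, b) - 1\<^sub>m d $$ (a, b)))\<^sup>2
        + (if a = b then 2 * Re (S $$ (b, b)) - 1 else 0))"
      by (intro sum.cong) auto
    then show ?thesis using b by (simp add: sum.distrib)
  qed
  then have "(\<Sum>b<d. \<Sum>a<d. (cmod (S $$ (a, b)))\<^sup>2) = (\<Sum>b<d. 2 * Re (S $$ (b, b)) - 1 +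
      (\<Sum>a<d. (cmod (S $$ (a, b) - 1\<^sub>m d $$ (a, b)))\<^sup>2))"
    by (intro sum.cong) auto
  also have "\<dots> = 2 * Re (mat_trace S) - real d +
      (\<Sum>b<d. \<Sum>a<d. (cmod (S $$ (a, b) - 1\<^sub>m d $$ (a, b)))\<^sup>2)"
    using S by (simp add: sum.distrib sum_subtractf sum_distrib_left mat_trace_def)
  finally show ?thesis .
qed

section \<open>Trace and spectrum of the complexified potential\<close>

lemma frame_op_hermitian:
  fixes V :: "nat \<Rightarrow> 'a::conjugatable_field mat"
  assumes "\<forall>i<m. V i \<in> carrier_mat l d"
  shows "mat_adjoint (frame_op m d V) = frame_op m d V"
proof -
  have "analysis_op m l d V \<in> carrier_mat (m * l) d" by (simp add: analysis_op_def)
  then show ?thesis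
    using mat_adjoint_mult[of "mat_adjoint (analysis_op m l d V)" d "m * l" "analysis_op m l d V" d]
    by (simp add: analysis_op_adjoint_mult[OF assms])
qed

lemma mat_trace_q_potential_complex:
  assumes V: "\<forall>i<m. V i \<in> carrier_mat l d"
  shows "mat_trace (q_potential_complex m l V) =
    mat_trace (complexify (frame_op m d V) * complexify (frame_op m d V))"
proof -
  have "q_potential m l V \<in> carrier_mat l l" by (simp add: q_potential_def)
  then have "mat_trace (q_potential_complex m l V)
      = to_complex (mat_trace (frame_op m d V * frame_op m d V))"
    using V by (simp add: q_potential_complex_def mat_trace_complexify mat_trace_q_potential[of m V l d])
  then show ?thesis
    by (simp add: mat_trace_complexify[symmetric, of _ d] mult_carrier_mat[of _ d d]
        complexify_mult[of _ d d _ d])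
qed

text \<open>The Gram form \<open>mat_adjoint T * T\<close> gives both the Hermitian symmetry needed
  to diagonalize and the nonnegativity of the eigenvalues.\<close>

lemma q_potential_complex_diagonalized:
  assumes V: "\<forall>i<m. V i \<in> carrier_mat l d"
  obtains U \<mu> where "diagonalized_by l (q_potential_complex m l V) U \<mu>" "\<And>i. i < l \<Longrightarrow> 0 \<le> \<mu> i"
proof -
  let ?P = "q_potential_complex m l V"
  have "\<And>i. i < m \<Longrightarrow> complexify (V i) \<in> carrier_mat l d" using V by auto
  then obtain T where T: "T \<in> carrier_mat (m * m * l) l" "?P = mat_adjoint T * T"
    using q_potential_eq_adjoint_mult[of m "\<lambda>i. complexify (V i)" l d] V
    by (auto simp: q_potential_complex_eq[of m V l d])
  have "?P \<in> carrier_mat l l" "mat_adjoint ?P = ?P"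
    using T by (auto simp: mat_adjoint_mult[of _ l "m * m * l" _ l] intro!: mult_carrier_mat[of _ l "m * m * l"])
  then obtain U \<mu> where "diagonalized_by l ?P U \<mu>"
    using hermitian_unitary_diagonalization[of ?P l] by (auto simp: diagonalized_by_def)
  moreover from this have "0 \<le> \<mu> i" if "i < l" for i
    using diagonalized_nonneg[OF _ T(1) that] by (simp add: T(2))
  ultimately show ?thesis by (rule that)
qed

section \<open>Projective protocols of full rank\<close>

lemma (in vec_space) not_distinct_cols_rank_less:
  assumes A: "A \<in> carrier_mat n nc" and "\<not> distinct (cols A)"
  shows "rank A < nc"
proof -
  \<comment> \<open>The rank is the size of a maximal independent subset of the columns; with a
    repeated column, fewer than \<open>nc\<close> vectors are available.\<close>
  obtain S where S: "maximal S (\<lambda>T. T \<subseteq> set (cols A) \<and> lin_indpt T)"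
    using maximal_exists_superset[of "set (cols A)" "\<lambda>T. T \<subseteq> set (cols A) \<and> lin_indpt T" "{}"]
    by (auto simp: lin_dep_def)
  then have "card S \<le> card (set (cols A))" by (intro card_mono) (auto simp: maximal_def)
  also have "\<dots> < nc"
    using assms card_distinct[of "cols A"] card_length[of "cols A"] by (force simp: le_less)
  finally show ?thesis using rank_card_indpt[OF A S] by simp
qed

text \<open>Full rank makes the columns of A distinct and independent, so a nonzero column of X
  would be a forbidden linear relation among them.\<close>

lemma (in vec_space) full_rank_mult_eq_0:
  assumes A: "A \<in> carrier_mat n k" and rank: "rank A = k"
    and X: "X \<in> carrier_mat k p" and 0: "A * X = 0\<^sub>m n p"
  shows "X = 0\<^sub>m k p"
proof -
  have dist: "distinct (cols A)" using not_distinct_cols_rank_less[OF A] rank by auto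
  have "col X j = 0\<^sub>v k" if j: "j < p" for j
  proof (rule ccontr)
    assume "col X j \<noteq> 0\<^sub>v k"
    moreover have "A *\<^sub>v col X j = 0\<^sub>v n"
      using col_mult2[OF A X j] j by (simp only: 0) simp
    moreover have "col X j \<in> carrier_vec k" using X j by auto
    ultimately show False
      using lin_depI[OF A _ _ _ dist] full_rank_lin_indpt[OF A rank dist] by blast
  qed
  then have "X $$ (i, j) = 0" if "i < k" "j < p" for i j
    using X that by (metis carrier_matD index_col index_zero_vec(1))
  then show ?thesis using X by (intro eq_matI) auto
qed

lemma minus_mat_eq_0D:
  fixes A B :: "'a::group_add mat"
  assumes "A \<in> carrier_mat n k" "B \<in> carrier_mat n k" and 0: "A - B = 0\<^sub>m n k"
  shows "A = B"
proof (rule eq_matI)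
  fix i j assume "i < dim_row B" "j < dim_col B"
  then show "A $$ (i, j) = B $$ (i, j)"
    using arg_cong[OF 0, of "\<lambda>M. M $$ (i, j)"] assms(1,2) by simp
qed (use assms in auto)

text \<open>First \<open>V * Q = V\<close>; then \<open>V V^* - a I\<close> annihilates V from the
  left. Since the adjoint of V has full column rank, it can be cancelled after taking
  adjoints.\<close>

lemma projection_full_rank_mult_adjoint:
  fixes V :: "'k::real_or_complex mat"
  assumes V: "V \<in> carrier_mat l d" and Q: "orthogonal_projection d Q"
    and G: "mat_adjoint V * V = a \<cdot>\<^sub>m Q" and rank: "vec_space.rank d (mat_adjoint V) = l"
  shows "V * mat_adjoint V = a \<cdot>\<^sub>m 1\<^sub>m l"
proof -
  have Qc: "Q \<in> carrier_mat d d" and QQ: "Q * Q = Q" and Qa: "mat_adjoint Q = Q"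
    using Q by (auto simp: orthogonal_projection_def)
  have VQ: "V * Q = V"
  proof -
    let ?Z = "V * (1\<^sub>m d - Q)"
    let ?R = "1\<^sub>m d - Q"
    have Rc: "?R \<in> carrier_mat d d" using Qc by (rule minus_carrier_mat)
    have Ra: "mat_adjoint ?R = ?R"
    proof (rule eq_matI)
      fix i j assume "i < dim_row ?R" "j < dim_col ?R"
      then have ij: "i < d" "j < d" using Qc by auto
      have "conjugate (Q $$ (j, i)) = Q $$ (i, j)"
        using arg_cong[OF Qa, of "\<lambda>M. M $$ (i, j)"] ij Qc by simp
      moreover have "conjugate (x - y) = conjugate x - conjugate y" for x y :: 'k
        using conjugate_dist_add[of x "- y"] by (simp add: conjugate_neg)
      moreover have "conjugate (1 :: 'k) = 1"
        using to_complex_conjugate[of "1 :: 'k"] to_complex_eq_iff[of "conjugate 1" "1 :: 'k"] by simp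
      ultimately show "mat_adjoint ?R $$ (i, j) = ?R $$ (i, j)" using ij Qc by auto
    qed (use Qc in auto)
    \<comment> \<open>The Gram matrix of \<open>?Z\<close> contains the factor
      \<open>Q * (1\<^sub>m d - Q)\<close>, which is 0 by idempotence; definiteness then gives
      \<open>?Z = 0\<close>.\<close>
    have "mat_adjoint ?Z * ?Z = ?R * (mat_adjoint V * V * ?R)"
      using V Rc by (simp add: mat_adjoint_mult[of _ l d _ d] Ra assoc_mult_mat[of _ d d _ l _ d]
          assoc_mult_mat[of _ d l _ d _ d] mult_carrier_mat[of _ l d])
    also have "mat_adjoint V * V * ?R = a \<cdot>\<^sub>m (Q * ?R)"
      unfolding G using Qc Rc by (simp add: mult_smult_assoc_mat[of _ d d])
    also have "Q * ?R = 0\<^sub>m d d"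
      using Qc by (simp add: mult_minus_distrib_mat[of _ d d _ d] QQ right_mult_one_mat[of _ d d])
    also have "a \<cdot>\<^sub>m 0\<^sub>m d d = (0\<^sub>m d d :: 'k mat)"
      by (rule eq_matI) auto
    also have "?R * 0\<^sub>m d d = 0\<^sub>m d d"
      using Rc by (rule right_mult_zero_mat)
    finally have "mat_adjoint ?Z * ?Z = 0\<^sub>m d d" .
    with mult_carrier_mat[OF V Rc] have "?Z = 0\<^sub>m l d"
      by (rule mat_adjoint_mult_self_eq_0)
    then have "V - V * Q = 0\<^sub>m l d"
      using V Qc by (simp add: mult_minus_distrib_mat[of _ l d _ d] right_mult_one_mat[of _ l d])
    with V mult_carrier_mat[OF V Qc] have "V = V * Q" by (rule minus_mat_eq_0D)
    then show ?thesis ..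
  qed
  define X where "X = V * mat_adjoint V - a \<cdot>\<^sub>m 1\<^sub>m l"
  have c: "V * mat_adjoint V \<in> carrier_mat l l" "a \<cdot>\<^sub>m 1\<^sub>m l \<in> carrier_mat l l"
    using V by auto
  have Xc: "X \<in> carrier_mat l l" unfolding X_def by (rule minus_carrier_mat[OF c(2)])
  have "X * V = V * mat_adjoint V * V - a \<cdot>\<^sub>m 1\<^sub>m l * V"
    unfolding X_def using c V by (rule minus_mult_distrib_mat)
  \<comment> \<open>Regrouping gives \<open>V * (a \<cdot>\<^sub>m Q)\<close>, and Q is absorbed by
    V.\<close>
  also have "V * mat_adjoint V * V = a \<cdot>\<^sub>m V"
    by (simp only: assoc_mult_mat[OF V mat_adjoint_carrier[OF V] V] G mult_smult_distrib[OF V Qc] VQ)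
  also have "a \<cdot>\<^sub>m 1\<^sub>m l * V = a \<cdot>\<^sub>m V"
    by (simp only: mult_smult_assoc_mat[OF one_carrier_mat V] left_mult_one_mat[OF V])
  also have "a \<cdot>\<^sub>m V - a \<cdot>\<^sub>m V = 0\<^sub>m l d" using V by (intro eq_matI) auto
  finally have "X * V = 0\<^sub>m l d" .
  moreover have "mat_adjoint (X * V) = mat_adjoint V * mat_adjoint X"
    using Xc V by (rule mat_adjoint_mult)
  ultimately have "mat_adjoint V * mat_adjoint X = 0\<^sub>m d l"
    by (simp only: mat_adjoint_zero)
  with mat_adjoint_carrier[OF V] rank mat_adjoint_carrier[OF Xc] have "mat_adjoint X = 0\<^sub>m l l"
    by (rule vec_space.full_rank_mult_eq_0)
  then have "mat_adjoint (mat_adjoint X) = 0\<^sub>m l l" by (simp only: mat_adjoint_zero)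
  then have "V * mat_adjoint V - a \<cdot>\<^sub>m 1\<^sub>m l = 0\<^sub>m l l"
    by (simp only: mat_adjoint_adjoint X_def)
  with c show ?thesis by (rule minus_mat_eq_0D)
qed

text \<open>With S = I the potential is the sum of the scalar matrices \<open>V_j V_j^*\<close>,
  hence c I for some c. Comparing traces gives \<open>l c = tr (S S) = d\<close>.\<close>

lemma q_potential_projective_protocol:
  fixes V :: "nat \<Rightarrow> 'k::real_or_complex mat"
  assumes proj: "projective_protocol m l d V" and rank: "rank_l m l d V" and l: "0 < l"
  shows "q_potential_complex m l V = complex_of_real (real d / real l) \<cdot>\<^sub>m 1\<^sub>m l"
proof -
  have V: "\<forall>i<m. V i \<in> carrier_mat l d" and S: "frame_op m d V = 1\<^sub>m d"
    using proj by (auto simp: projective_protocol_def protocol_def reconstruction_system_def)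
  have "\<forall>j\<in>{..<m}. \<exists>a. V j * mat_adjoint (V j) = a \<cdot>\<^sub>m 1\<^sub>m l"
  proof
    fix j assume j: "j \<in> {..<m}"
    then obtain w :: real and Q where "orthogonal_projection d Q"
      "mat_adjoint (V j) * V j = of_real w \<cdot>\<^sub>m Q"
      using proj by (auto simp: projective_protocol_def)
    moreover have "vec_space.rank d (mat_adjoint (V j)) = l" using rank j by (simp add: rank_l_def)
    ultimately have "V j * mat_adjoint (V j) = of_real w \<cdot>\<^sub>m 1\<^sub>m l"
      using projection_full_rank_mult_adjoint V j by blast
    then show "\<exists>a. V j * mat_adjoint (V j) = a \<cdot>\<^sub>m 1\<^sub>m l" ..
  qed
  then obtain a where a: "\<And>j. j < m \<Longrightarrow> V j * mat_adjoint (V j) = a j \<cdot>\<^sub>m 1\<^sub>m l"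
    by (auto simp: bchoice_iff)
  define c where "c = to_complex (\<Sum>j<m. a j)"
  have "q_potential m l V = mat_sum l l (\<lambda>j. a j \<cdot>\<^sub>m 1\<^sub>m l) {..<m}"
    using V a by (subst q_potential_eq_sum_frame_op[of m V l d])
      (auto simp: S right_mult_one_mat[of _ l d] intro!: mat_sum_cong)
  then have P: "q_potential_complex m l V = c \<cdot>\<^sub>m 1\<^sub>m l"
    by (auto simp: q_potential_complex_def mat_sum_def c_def to_complex_sum intro!: eq_matI)
  have "mat_trace (q_potential_complex m l V) = of_nat d"
    by (simp add: mat_trace_q_potential_complex[OF V] S complexify_one) (simp add: mat_trace_def)
  then have "of_nat l * c = of_nat d" by (simp add: P mat_trace_def)
  then have "c = complex_of_real (real d / real l)" using l by (simp add: field_simps)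
  then show ?thesis by (simp add: P)
qed

lemma diagonalized_by_scalar: "diagonalized_by n (complex_of_real c \<cdot>\<^sub>m 1\<^sub>m n) (1\<^sub>m n) (\<lambda>_. c)"
proof -
  let ?D = "mat_diag n (\<lambda>_. complex_of_real c)"
  have adj: "mat_adjoint (1\<^sub>m n) = (1\<^sub>m n :: complex mat)" by (rule eq_matI) auto
  have "unitary_mat n (1\<^sub>m n)" by (rule unitary_matI) (simp_all add: adj)
  moreover have "complex_of_real c \<cdot>\<^sub>m 1\<^sub>m n = ?D" by (rule eq_matI) (auto simp: mat_diag_def)
  moreover have "1\<^sub>m n * ?D * 1\<^sub>m n = ?D"
    by (simp only: left_mult_one_mat[OF mat_diag_dim] right_mult_one_mat[OF mat_diag_dim])
  ultimately show ?thesis by (simp only: diagonalized_by_def adj simp_thms)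
qed

section \<open>The three bounds and their equality cases\<close>

theorem theorem3p3:
  fixes V :: "nat \<Rightarrow> 'k::real_or_complex mat"
    and m l d :: nat
  assumes "0 < l" and "l < d"
    and "reconstruction_system m l d V"
    and "of_nat d \<le> to_complex (mat_trace (mat_adjoint (analysis_op m l d V) * analysis_op m l d V))"
  shows
    "let P = q_potential_complex m l V;
         D = complex_of_real (real d / real l) \<cdot>\<^sub>m 1\<^sub>m l
     in
     mat_submajorized D P \<and>
     (\<forall>N \<psi>. unitarily_invariant_norm l N \<and> associated_gauge l N \<psi> \<longrightarrow>
        real d * eta \<psi> l \<le> N P) \<and>
     (\<forall>f. mono_on {0..} f \<and> convex_on {0..} f \<and> f 0 = 0 \<longrightarrow>
        complex_of_real (real l * f (real d / real l)) \<le> mat_trace (functional_calculus f P)) \<and>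
     (mat_majorized D P \<or>
      (\<exists>N \<psi>. unitarily_invariant_norm l N \<and> associated_gauge l N \<psi> \<and>
         real d * eta \<psi> l = N P) \<or>
      (\<exists>f. mono_on {0..} f \<and> strictly_convex_on {0..} f \<and> (\<forall>x\<ge>0. 0 \<le> f x) \<and> f 0 = 0 \<and>
         complex_of_real (real l * f (real d / real l)) = mat_trace (functional_calculus f P))
      \<longrightarrow> protocol m l d V) \<and>
     (projective_protocol m l d V \<and> rank_l m l d V \<longrightarrow>
        mat_majorized D P \<and>
        (\<forall>N \<psi>. unitarily_invariant_norm l N \<and> associated_gauge l N \<psi> \<longrightarrow>
           real d * eta \<psi> l = N P) \<and>
        (\<forall>f. mono_on {0..} f \<and> convex_on {0..} f \<and> f 0 = 0 \<longrightarrow>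
           complex_of_real (real l * f (real d / real l)) = mat_trace (functional_calculus f P)))"
proof -
  let ?P = "q_potential_complex m l V"
  let ?c = "real d / real l"
  let ?D = "complex_of_real ?c \<cdot>\<^sub>m 1\<^sub>m l :: complex mat"
  note l = assms(1)
  have V: "\<forall>i<m. V i \<in> carrier_mat l d"
    using assms(3) by (simp add: reconstruction_system_def)
  obtain U \<mu> where U: "diagonalized_by l ?P U \<mu>" and \<mu>: "\<And>i. i < l \<Longrightarrow> 0 \<le> \<mu> i"
    using q_potential_complex_diagonalized[OF V] by blast
  let ?t = "\<Sum>i<l. \<mu> i"
  let ?S = "complexify (frame_op m d V)"
  let ?E = "\<Sum>b<d. \<Sum>a<d. (cmod (?S $$ (a, b) - 1\<^sub>m d $$ (a, b)))\<^sup>2"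
  \<comment> \<open>The eigenvalue sum \<open>?t\<close> is linked to the frame operator through the
    trace; \<open>?E\<close> is the squared Frobenius distance from S to I.\<close>
  have "complex_of_real ?t = mat_trace (?S * ?S)"
    by (simp only: mat_trace_diagonalized[OF U, symmetric] mat_trace_q_potential_complex[OF V])
  also have "\<dots> = complex_of_real (2 * Re (mat_trace ?S) - real d + ?E)"
    by (rule mat_trace_square_hermitian)
      (simp_all add: complexify_adjoint[symmetric] frame_op_hermitian[OF V])
  finally have t: "?t = 2 * Re (mat_trace ?S) - real d + ?E" by (simp only: of_real_eq_iff)
  \<comment> \<open>The trace hypothesis is an inequality in the complex order, from which the
    comparison of real parts is taken.\<close>
  have tr: "real d \<le> Re (mat_trace ?S)"
    using assms(4)
    by (simp add: analysis_op_adjoint_mult[OF V] mat_trace_complexify[of _ d] less_eq_complex_def)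
  have E: "0 \<le> ?E" by (intro sum_nonneg) auto
  have td: "real d \<le> ?t" using t tr E by linarith
  \<comment> \<open>\<open>?t\<close> is at least \<open>d + ?E\<close>, so \<open>?t = d\<close>
    forces every squared entry of S - I to vanish.\<close>
  have protocol: "protocol m l d V" if "?t = real d"
  proof -
    have "?E = 0" using t tr E that by linarith
    then have "?S $$ (a, b) = 1\<^sub>m d $$ (a, b)" if "a < d" "b < d" for a b
      using that by (simp add: sum_nonneg_eq_0_iff sum_nonneg)
    then have "?S = complexify (1\<^sub>m d :: 'k mat)"
      unfolding complexify_one using carrier_matD[OF frame_op_carrier[of m d V]]
      by (intro eq_matI) auto
    then show ?thesis using assms(3) by (simp add: protocol_def complexify_eq_iff)
  qed
  have mean: "?c \<le> ?t / real l" using td by (simp add: divide_right_mono)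
  have mean_eqD: "?t = real d" if "?c = ?t / real l" using that l by (simp add: field_simps)
  let ?ev = "vec_of_list (rev (sort (map \<mu> [0..<l])))"
  have evP: "eigenvalue_vec ?P = ?ev" by (rule eigenvalue_vec_diagonalized[OF U])
  have evD: "eigenvalue_vec ?D = vec_of_list (replicate l ?c)"
    using eigenvalue_vec_diagonalized[OF diagonalized_by_scalar[of l ?c]]
    by (simp add: map_replicate_const rev_sort_replicate)
  have ev_sum: "(\<Sum>i<l. ?ev $ i) = ?t"
    by (simp add: sum_vec_of_list sum_list_sort_map_upt)
  have sub: "mat_submajorized ?D ?P"
    unfolding mat_submajorized_def evP evD using td l by (intro submajorized_mean) simp
  \<comment> \<open>Submajorization is already known, so what remains is the equality of the totals,
    which are d and \<open>?t\<close>.\<close>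
  have maj: "mat_majorized ?D ?P \<longleftrightarrow> ?t = real d"
  proof -
    have "(\<Sum>i<l. vec_of_list (replicate l ?c) $ i) = real d"
      using l by (simp add: sum_vec_of_list sum_list_replicate)
    then show ?thesis
      using sub ev_sum unfolding mat_majorized_def majorized_def mat_submajorized_def evP evD by auto
  qed
  \<comment> \<open>The eigenvalues are nonnegative, so they are also the singular values, and
    averaging them cannot increase the gauge.\<close>
  have norm_ge: "\<psi> (vec l (\<lambda>_. 1)) * (?t / real l) \<le> N ?P" if "associated_gauge l N \<psi>" for N \<psi>
  proof -
    have "N ?P = \<psi> ?ev"
      using that diagonalized_byD(2)[OF U] singular_value_vec_diagonalized[OF U \<mu>]
      by (simp add: associated_gauge_def)
    moreover have "?ev \<in> carrier_vec l" by (rule carrier_vecI) simp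
    ultimately show ?thesis
      using symmetric_gauge_mean_le[OF _ l, of \<psi> ?ev] that by (simp add: associated_gauge_def ev_sum)
  qed
  have eta: "real d * eta \<psi> l = \<psi> (vec l (\<lambda>_. 1)) * ?c" for \<psi> by (simp add: eta_def)
  have gauge_pos: "0 < \<psi> (vec l (\<lambda>_. 1))" if "associated_gauge l N \<psi>" for N \<psi>
    using that l by (auto simp: associated_gauge_def intro: symmetric_gauge_one_pos)
  have norm: "real d * eta \<psi> l \<le> N ?P" if "associated_gauge l N \<psi>" for N \<psi>
    using norm_ge[OF that] mult_left_mono[OF mean, of "\<psi> (vec l (\<lambda>_. 1))"] gauge_pos[OF that]
    unfolding eta by linarith
  \<comment> \<open>Equality collapses the chain through \<open>?t / l\<close>; cancelling the
    positive gauge of the all-ones vector leaves \<open>?t / l = d / l\<close>.\<close>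
  have norm_eq: "?t = real d" if g: "associated_gauge l N \<psi>" and "real d * eta \<psi> l = N ?P" for N \<psi>
  proof -
    have "\<psi> (vec l (\<lambda>_. 1)) * (?t / real l) \<le> \<psi> (vec l (\<lambda>_. 1)) * ?c"
      using norm_ge[OF g] that(2) unfolding eta by simp
    then have "?t / real l \<le> ?c" using gauge_pos[OF g] by (simp only: mult_le_cancel_left_pos)
    then show ?thesis using mean by (intro mean_eqD) linarith
  qed
  have tr_fun: "mat_trace (functional_calculus f ?P) = complex_of_real (\<Sum>i<l. f (\<mu> i))" for f
    by (rule mat_trace_diagonalized[OF functional_calculus_diagonalized[OF U]])
  have fun_ge: "real l * f (?t / real l) \<le> (\<Sum>i<l. f (\<mu> i))" if "convex_on {0..} f" for f
    using convex_on_mean_le[OF that l \<mu>] .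
  \<comment> \<open>Monotonicity passes from d/l to the mean of the eigenvalues, and Jensen's
    inequality from the mean to the trace.\<close>
  have fun_le: "real l * f ?c \<le> (\<Sum>i<l. f (\<mu> i))" if "mono_on {0..} f" "convex_on {0..} f" for f
  proof -
    have "0 \<le> ?c" by simp
    then have "f ?c \<le> f (?t / real l)"
      using mean by (intro mono_onD[OF that(1)]) (simp_all only: atLeast_iff order_trans)
    then have "real l * f ?c \<le> real l * f (?t / real l)" by (intro mult_left_mono) auto
    then show ?thesis using fun_ge[OF that(2)] by linarith
  qed
  \<comment> \<open>If the mean exceeded d/l, the monotonicity step would be strict, leaving no room
    for equality.\<close>
  have fun_eq: "?t = real d"
    if f: "mono_on {0..} f" "strictly_convex_on {0..} f" and eq: "real l * f ?c = (\<Sum>i<l. f (\<mu> i))" for f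
  proof (rule ccontr)
    assume "?t \<noteq> real d"
    then have "?c < ?t / real l" using mean mean_eqD by linarith
    then have "f ?c < f (?t / real l)"
      by (intro strictly_convex_mono_imp_strict_mono[OF f]) auto
    then have "real l * f ?c < real l * f (?t / real l)" using l by simp
    then show False
      using fun_ge[OF strictly_convex_on_imp_convex_on[OF f(2)]] eq by linarith
  qed
  have attained: "mat_majorized ?D ?P"
    "\<And>N \<psi>. associated_gauge l N \<psi> \<Longrightarrow> real d * eta \<psi> l = N ?P"
    "\<And>f. complex_of_real (real l * f ?c) = mat_trace (functional_calculus f ?P)"
    if "projective_protocol m l d V" "rank_l m l d V"
  proof -
    \<comment> \<open>Once the potential is the scalar matrix itself, its eigenvalues and singular
      values all equal d/l, and each bound becomes an equality.\<close>
    have P: "?P = ?D" using that l by (rule q_potential_projective_protocol)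
    have D: "diagonalized_by l ?D (1\<^sub>m l) (\<lambda>_. ?c)" by (rule diagonalized_by_scalar)
    show "mat_majorized ?D ?P"
      unfolding P using sub by (simp add: P mat_majorized_def majorized_def mat_submajorized_def)
    show "real d * eta \<psi> l = N ?P" if g: "associated_gauge l N \<psi>" for N \<psi>
    proof -
      have "singular_value_vec ?D = vec_of_list (replicate l ?c)"
        using singular_value_vec_diagonalized[OF D]
        by (simp add: map_replicate_const rev_sort_replicate)
      also have "\<dots> = ?c \<cdot>\<^sub>v vec l (\<lambda>_. 1)"
        by (rule eq_vecI) (auto simp: vec_of_list_index)
      finally have "N ?D = \<psi> (?c \<cdot>\<^sub>v vec l (\<lambda>_. 1))"
        using g by (simp add: associated_gauge_def)
      also have "\<dots> = ?c * \<psi> (vec l (\<lambda>_. 1))"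
        using g by (simp add: associated_gauge_def symmetric_gauge_def)
      finally show ?thesis unfolding P eta by simp
    qed
    show "complex_of_real (real l * f ?c) = mat_trace (functional_calculus f ?P)" for f
      unfolding P using mat_trace_diagonalized[OF functional_calculus_diagonalized[OF D, of f]] by simp
  qed
  \<comment> \<open>The trace bound is stated in the complex order, which on embedded reals is the
    real one.\<close>
  have of_real_le: "complex_of_real x \<le> complex_of_real y \<longleftrightarrow> x \<le> y" for x y
    by (simp add: less_eq_complex_def)
  have all_equality: "mat_majorized ?D ?P \<or>
      (\<exists>N \<psi>. unitarily_invariant_norm l N \<and> associated_gauge l N \<psi> \<and> real d * eta \<psi> l = N ?P) \<or>
      (\<exists>f. mono_on {0..} f \<and> strictly_convex_on {0..} f \<and> (\<forall>x\<ge>0. 0 \<le> f x) \<and> f 0 = 0 \<and>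
         complex_of_real (real l * f ?c) = mat_trace (functional_calculus f ?P))
      \<longrightarrow> protocol m l d V"
  proof (intro impI, elim disjE exE conjE)
    show "protocol m l d V" if "mat_majorized ?D ?P"
      using that protocol by (simp only: maj)
    show "protocol m l d V" if "associated_gauge l N \<psi>" "real d * eta \<psi> l = N ?P" for N \<psi>
      using that by (intro protocol norm_eq)
    show "protocol m l d V" if "mono_on {0..} f" "strictly_convex_on {0..} f"
      "complex_of_real (real l * f ?c) = mat_trace (functional_calculus f ?P)" for f
      using fun_eq[OF that(1,2)] that(3) protocol by (simp only: tr_fun of_real_eq_iff)
  qed
  have all_norms: "\<forall>N \<psi>. unitarily_invariant_norm l N \<and> associated_gauge l N \<psi> \<longrightarrow>
      real d * eta \<psi> l \<le> N ?P"
  proof (intro allI impI, elim conjE)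
    show "real d * eta \<psi> l \<le> N ?P" if "associated_gauge l N \<psi>" for N \<psi>
      by (rule norm[of N \<psi>]) (rule that)
  qed
  have all_funs: "\<forall>f. mono_on {0..} f \<and> convex_on {0..} f \<and> f 0 = 0 \<longrightarrow>
      complex_of_real (real l * f ?c) \<le> mat_trace (functional_calculus f ?P)"
    unfolding tr_fun of_real_le
  proof (intro allI impI, elim conjE)
    show "real l * f ?c \<le> (\<Sum>i<l. f (\<mu> i))" if "mono_on {0..} f" "convex_on {0..} f" for f
      by (rule fun_le[of f]) (fact that)+
  qed
  have all_attained: "projective_protocol m l d V \<and> rank_l m l d V \<longrightarrow> mat_majorized ?D ?P \<and>
      (\<forall>N \<psi>. unitarily_invariant_norm l N \<and> associated_gauge l N \<psi> \<longrightarrow> real d * eta \<psi> l = N ?P) \<and>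
      (\<forall>f. mono_on {0..} f \<and> convex_on {0..} f \<and> f 0 = 0 \<longrightarrow>
         complex_of_real (real l * f ?c) = mat_trace (functional_calculus f ?P))"
  proof (intro impI, elim conjE)
    assume pr: "projective_protocol m l d V" "rank_l m l d V"
    have "\<forall>N \<psi>. unitarily_invariant_norm l N \<and> associated_gauge l N \<psi> \<longrightarrow> real d * eta \<psi> l = N ?P"
    proof (intro allI impI, elim conjE)
      show "real d * eta \<psi> l = N ?P" if "associated_gauge l N \<psi>" for N \<psi>
        by (rule attained(2)[OF pr, of N \<psi>]) (rule that)
    qed
    with attained(1)[OF pr] attained(3)[OF pr] show
      "mat_majorized ?D ?P \<and>
      (\<forall>N \<psi>. unitarily_invariant_norm l N \<and> associated_gauge l N \<psi> \<longrightarrow> real d * eta \<psi> l = N ?P) \<and>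
      (\<forall>f. mono_on {0..} f \<and> convex_on {0..} f \<and> f 0 = 0 \<longrightarrow>
         complex_of_real (real l * f ?c) = mat_trace (functional_calculus f ?P))"
      by (simp only: simp_thms)
  qed
  show ?thesis
    unfolding Let_def
    by (rule conjI[OF sub conjI[OF all_norms conjI[OF all_funs conjI[OF all_equality all_attained]]]])
qed

end
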